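(* Let $K\in\mathcal{K}$ be an admissible kernel. Assume there exist Lagrange multipliers $\lambda:=(\lambda^i)_{i\in\{1,2,3,4\}}\in(\mathcal{L}^1_+)^4$ such that the process $$\varphi_t=\lambda^1_t-\lambda^2_t+\mathbb{E}_t\Big[\int_t^T(\lambda^3_s-\lambda^4_s)\,ds\Big]$$ is in $\mathcal{L}^2$. Let $u^*\in\mathcal{L}^2$ be the solution to the stochastic Fredholm equation $$u^*_t+\int_0^tK(t,s)u^*_s\,ds+\int_t^TK(s,t)\,\mathbb{E}_tu^*_s\,ds=\varphi_t+\alpha_t\quad dt\otimes\mathbb{P}\text{-a.e.}$$ If $u^*\in\mathcal{U}$ and $(u^*,\lambda)$ satisfies the complementary slackness conditions $$0=\mathbb{E}\Big[\int_0^T(a^1_t-u^*_t)\lambda^1_t\,dt\Big],\quad 0=\mathbb{E}\Big[\int_0^T(u^*_t-a^2_t)\lambda^2_t\,dt\Big],$$ $$0=\mathbb{E}\Big[\int_0^T(a^3_t-X^{u^*}_t)\lambda^3_t\,dt\Big],\quad 0=\mathbb{E}\Big[\int_0^T(X^{u^*}_t-a^4_t)\lambda^4_t\,dt\Big],$$ then $u^*=\hat u$, where $\hat u$ is the unique element of $\mathcal{U}$ with $\mathcal{J}(\hat u)=\inf_{u\in\mathcal{U}}\mathcal{J}(u)$.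
   Context: Fix $T>0$ and a filtered probability space $(\Omega,\mathcal{F},(\mathcal{F}_t)_{t\in[0,T]},\mathbb{P})$ satisfying the usual conditions, with $\Omega$ Polish. $\mathbb{E}_t=\mathbb{E}[\cdot\mid\mathcal{F}_t]$. For $p\ge1$, $\mathcal{L}^p$ is the space of progressively measurable $f:[0,T]\times\Omega\to\mathbb{R}$ with $\int_0^T\mathbb{E}[|f_t|^p]dt<\infty$; $\mathcal{L}^\infty$ is the space of progressively measurable $f$ that are bounded $dt\otimes\mathbb{P}$-a.e., a Banach space with the essential supremum norm. $\mathcal{L}^1_+$ is the set of a.e. non-negative elements of $\mathcal{L}^1$. $L^2=L^2([0,T])$ with Lebesgue measure. Inventory: $X_0\in\mathbb{R}$ is given and $X^u_t:=X_0+\int_0^t u_s\,ds$. Price: $S_t=P_t+M_t$, with $M$ a centered square-integrable martingale and $P$ a finite variation process in $\mathcal{L}^2$; $\alpha_t:=\mathbb{E}_t[P_T-P_t]$. Admissible kernels: $K\in\mathcal{K}$ if $K:[0,T]^2\to\mathbb{R}_+$ is measurable, $K(t,s)=0$ for $0\le t<s\le T$, $\int_0^T\int_0^TK(t,s)^2\,ds\,dt<\infty$, and $\int_0^T\int_0^TK(t,s)f(s)f(t)\,ds\,dt\ge0$ for all $f\in L^2$. Cost functional (with the slippage intensity normalized to $\gamma\equiv1$): $$\mathcal{J}(u):=\mathbb{E}\Big[\int_0^T\Big(S_t+\tfrac12u_t+\int_0^tK(t,s)u_s\,ds\Big)u_t\,dt-X^u_TS_T\Big].$$ Constraints: $a^1,a^2,a^3,a^4\in\mathcal{L}^\infty$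 with $a^1\le a^2$, $a^3\le a^4$ and $a^3_0\le X_0\le a^4_0$, and $$\mathcal{U}:=\{u\in\mathcal{L}^\infty:\ a^1_t\le u_t\le a^2_t\ \text{and}\ a^3_t\le X^u_t\le a^4_t\ \ dt\otimes\mathbb{P}\text{-a.e.}\}.$$ Whenever $\mathcal{U}\ne\emptyset$ and $K\in\mathcal{K}$, the functional $\mathcal{J}$ has a unique minimizer $\hat u$ over $\mathcal{U}$. Equality of controls is $dt\otimes\mathbb{P}$-a.e. *)

theory Defs
  imports "HOL-Probability.Probability"
begin

text \<open>
  Stochastic processes on \<open>[0,T]\<close> are functions \<open>real \<Rightarrow> 'w \<Rightarrow> real\<close>; their values outside
  \<open>{0..T}\<close> never matter.  Throughout, \<open>\<mu>\<close> is the probability measure and \<open>F\<close> the filtration.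
\<close>

definition time_measure :: "real \<Rightarrow> real measure" where
  "time_measure T = restrict_space lborel {0..T}"

definition usual_filtration :: "'w::polish_space measure \<Rightarrow> (real \<Rightarrow> 'w measure) \<Rightarrow> real \<Rightarrow> bool" where
  "usual_filtration \<mu> F T \<longleftrightarrow>
     prob_space \<mu> \<and> complete_measure \<mu> \<and> space \<mu> = UNIV \<and> sets borel \<subseteq> sets \<mu> \<and>
     (\<forall>t\<in>{0..T}. subalgebra \<mu> (F t)) \<and>
     (\<forall>s\<in>{0..T}. \<forall>t\<in>{0..T}. s \<le> t \<longrightarrow> sets (F s) \<subseteq> sets (F t)) \<and>
     null_sets \<mu> \<subseteq> sets (F 0) \<and>
     (\<forall>t\<in>{0..<T}. sets (F t) = (\<Inter>s\<in>{t<..T}. sets (F s)))"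

definition progressive :: "(real \<Rightarrow> 'w measure) \<Rightarrow> real \<Rightarrow> (real \<Rightarrow> 'w \<Rightarrow> real) \<Rightarrow> bool" where
  "progressive F T f \<longleftrightarrow>
     (\<forall>t\<in>{0..T}. (\<lambda>(s, \<omega>). f s \<omega>) \<in> borel_measurable (restrict_space borel {0..t} \<Otimes>\<^sub>M F t))"

definition ae_dt_prob :: "'w measure \<Rightarrow> real \<Rightarrow> (real \<Rightarrow> 'w \<Rightarrow> bool) \<Rightarrow> bool" where
  "ae_dt_prob \<mu> T Q \<longleftrightarrow> (AE (t, \<omega>) in time_measure T \<Otimes>\<^sub>M \<mu>. Q t \<omega>)"

definition Lp_proc :: "'w measure \<Rightarrow> (real \<Rightarrow> 'w measure) \<Rightarrow> real \<Rightarrow> real \<Rightarrow> (real \<Rightarrow> 'w \<Rightarrow> real) set" where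
  "Lp_proc \<mu> F T p =
     {f. progressive F T f \<and>
         (\<integral>\<^sup>+t. (\<integral>\<^sup>+\<omega>. ennreal (\<bar>f t \<omega>\<bar> powr p) \<partial>\<mu>) \<partial>time_measure T) < \<infinity>}"

definition L1_plus :: "'w measure \<Rightarrow> (real \<Rightarrow> 'w measure) \<Rightarrow> real \<Rightarrow> (real \<Rightarrow> 'w \<Rightarrow> real) set" where
  "L1_plus \<mu> F T = {f \<in> Lp_proc \<mu> F T 1. ae_dt_prob \<mu> T (\<lambda>t \<omega>. 0 \<le> f t \<omega>)}"

definition Linf_proc :: "'w measure \<Rightarrow> (real \<Rightarrow> 'w measure) \<Rightarrow> real \<Rightarrow> (real \<Rightarrow> 'w \<Rightarrow> real) set" where
  "Linf_proc \<mu> F T =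
     {f. progressive F T f \<and> (\<exists>C. ae_dt_prob \<mu> T (\<lambda>t \<omega>. \<bar>f t \<omega>\<bar> \<le> C))}"

text \<open>
  \<open>real_cond_exp \<mu> (F t)\<close> picks an arbitrary version for each \<open>t\<close>, so
  \<open>(t, \<omega>) \<mapsto> real_cond_exp \<mu> (F t) (Z t) \<omega>\<close> need not be measurable.  The process
  \<open>t \<mapsto> E\<^sub>t[Z\<^sub>t]\<close> is therefore represented by a progressively measurable version \<open>Y\<close>, which is
  unique up to \<open>dt \<otimes> \<mu>\<close>-null sets.
\<close>

definition cond_exp_process ::
  "'w measure \<Rightarrow> (real \<Rightarrow> 'w measure) \<Rightarrow> real \<Rightarrow> (real \<Rightarrow> 'w \<Rightarrow> real) \<Rightarrow> (real \<Rightarrow> 'w \<Rightarrow> real) \<Rightarrow> bool" where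
  "cond_exp_process \<mu> F T Z Y \<longleftrightarrow>
     progressive F T Y \<and>
     (AE t in time_measure T. AE \<omega> in \<mu>. Y t \<omega> = real_cond_exp \<mu> (F t) (Z t) \<omega>)"

text \<open>Likewise, \<open>V t s \<omega>\<close> is a jointly measurable version of the two-parameter field \<open>E\<^sub>t[u\<^sub>s](\<omega>)\<close>.\<close>

definition cond_exp_field ::
  "'w measure \<Rightarrow> (real \<Rightarrow> 'w measure) \<Rightarrow> real \<Rightarrow> (real \<Rightarrow> 'w \<Rightarrow> real) \<Rightarrow> (real \<Rightarrow> real \<Rightarrow> 'w \<Rightarrow> real) \<Rightarrow> bool" where
  "cond_exp_field \<mu> F T u V \<longleftrightarrow>
     (\<lambda>(t, s, \<omega>). V t s \<omega>) \<in> borel_measurable (time_measure T \<Otimes>\<^sub>M time_measure T \<Otimes>\<^sub>M \<mu>) \<and>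
     (AE t in time_measure T. AE s in time_measure T. AE \<omega> in \<mu>.
        V t s \<omega> = real_cond_exp \<mu> (F t) (u s) \<omega>)"

text \<open>
  Progressive measurability stands in for the usual choice of a cadlag version, which implies it;
  it makes path integrals such as \<open>\<integral> M\<^sub>t u\<^sub>t dt\<close> meaningful.
\<close>

definition square_int_martingale ::
  "'w measure \<Rightarrow> (real \<Rightarrow> 'w measure) \<Rightarrow> real \<Rightarrow> (real \<Rightarrow> 'w \<Rightarrow> real) \<Rightarrow> bool" where
  "square_int_martingale \<mu> F T M \<longleftrightarrow>
     progressive F T M \<and>
     (\<forall>t\<in>{0..T}. M t \<in> borel_measurable (F t) \<and> integrable \<mu> (\<lambda>\<omega>. (M t \<omega>)\<^sup>2)) \<and>
     (\<forall>s\<in>{0..T}. \<forall>t\<in>{0..T}. s \<le> t \<longrightarrow> (AE \<omega> in \<mu>. real_cond_exp \<mu> (F s) (M t) \<omega> = M s \<omega>))"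

definition centered :: "'w measure \<Rightarrow> real \<Rightarrow> (real \<Rightarrow> 'w \<Rightarrow> real) \<Rightarrow> bool" where
  "centered \<mu> T M \<longleftrightarrow> (\<forall>t\<in>{0..T}. (\<integral>\<omega>. M t \<omega> \<partial>\<mu>) = 0)"

definition bounded_variation_on_interval :: "real \<Rightarrow> real \<Rightarrow> (real \<Rightarrow> real) \<Rightarrow> bool" where
  "bounded_variation_on_interval a b f \<longleftrightarrow>
     (\<exists>C. \<forall>n. \<forall>\<tau>::nat \<Rightarrow> real. mono_on {..n} \<tau> \<longrightarrow> \<tau> ` {..n} \<subseteq> {a..b} \<longrightarrow>
        (\<Sum>i<n. \<bar>f (\<tau> (Suc i)) - f (\<tau> i)\<bar>) \<le> C)"

definition finite_variation_process :: "'w measure \<Rightarrow> real \<Rightarrow> (real \<Rightarrow> 'w \<Rightarrow> real) \<Rightarrow> bool" where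
  "finite_variation_process \<mu> T A \<longleftrightarrow>
     (AE \<omega> in \<mu>. bounded_variation_on_interval 0 T (\<lambda>t. A t \<omega>))"

definition L2_fun :: "real \<Rightarrow> (real \<Rightarrow> real) set" where
  "L2_fun T = {f \<in> borel_measurable (time_measure T).
                 (\<integral>\<^sup>+t. ennreal ((f t)\<^sup>2) \<partial>time_measure T) < \<infinity>}"

definition admissible_kernel :: "real \<Rightarrow> (real \<Rightarrow> real \<Rightarrow> real) \<Rightarrow> bool" where
  "admissible_kernel T K \<longleftrightarrow>
     (\<lambda>(t, s). K t s) \<in> borel_measurable (time_measure T \<Otimes>\<^sub>M time_measure T) \<and>
     (\<forall>t\<in>{0..T}. \<forall>s\<in>{0..T}. 0 \<le> K t s) \<and>
     (\<forall>t\<in>{0..T}. \<forall>s\<in>{0..T}. t < s \<longrightarrow> K t s = 0) \<and>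
     (\<integral>\<^sup>+t. (\<integral>\<^sup>+s. ennreal ((K t s)\<^sup>2) \<partial>time_measure T) \<partial>time_measure T) < \<infinity> \<and>
     (\<forall>f\<in>L2_fun T. 0 \<le> (\<integral>t. (\<integral>s. K t s * f s * f t \<partial>time_measure T) \<partial>time_measure T))"

definition inventory :: "real \<Rightarrow> (real \<Rightarrow> 'w \<Rightarrow> real) \<Rightarrow> real \<Rightarrow> 'w \<Rightarrow> real" where
  "inventory X0 u t \<omega> = X0 + (LINT s:{0..t}|lborel. u s \<omega>)"

definition cost :: "'w measure \<Rightarrow> real \<Rightarrow> (real \<Rightarrow> real \<Rightarrow> real) \<Rightarrow> real \<Rightarrow> (real \<Rightarrow> 'w \<Rightarrow> real)
    \<Rightarrow> (real \<Rightarrow> 'w \<Rightarrow> real) \<Rightarrow> real" where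
  "cost \<mu> T K X0 S u =
     (\<integral>\<omega>. (\<integral>t. (S t \<omega> + 1/2 * u t \<omega> + (LINT s:{0..t}|lborel. K t s * u s \<omega>)) * u t \<omega> \<partial>time_measure T)
           - inventory X0 u T \<omega> * S T \<omega> \<partial>\<mu>)"

definition constraint_processes ::
  "'w measure \<Rightarrow> (real \<Rightarrow> 'w measure) \<Rightarrow> real \<Rightarrow> real \<Rightarrow> (real \<Rightarrow> 'w \<Rightarrow> real) \<Rightarrow> (real \<Rightarrow> 'w \<Rightarrow> real)
    \<Rightarrow> (real \<Rightarrow> 'w \<Rightarrow> real) \<Rightarrow> (real \<Rightarrow> 'w \<Rightarrow> real) \<Rightarrow> bool" where
  "constraint_processes \<mu> F T X0 a1 a2 a3 a4 \<longleftrightarrow>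
     {a1, a2, a3, a4} \<subseteq> Linf_proc \<mu> F T \<and>
     ae_dt_prob \<mu> T (\<lambda>t \<omega>. a1 t \<omega> \<le> a2 t \<omega>) \<and>
     ae_dt_prob \<mu> T (\<lambda>t \<omega>. a3 t \<omega> \<le> a4 t \<omega>) \<and>
     (AE \<omega> in \<mu>. a3 0 \<omega> \<le> X0 \<and> X0 \<le> a4 0 \<omega>)"

definition admissible_controls ::
  "'w measure \<Rightarrow> (real \<Rightarrow> 'w measure) \<Rightarrow> real \<Rightarrow> real \<Rightarrow> (real \<Rightarrow> 'w \<Rightarrow> real) \<Rightarrow> (real \<Rightarrow> 'w \<Rightarrow> real)
    \<Rightarrow> (real \<Rightarrow> 'w \<Rightarrow> real) \<Rightarrow> (real \<Rightarrow> 'w \<Rightarrow> real) \<Rightarrow> (real \<Rightarrow> 'w \<Rightarrow> real) set" where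
  "admissible_controls \<mu> F T X0 a1 a2 a3 a4 =
     {u \<in> Linf_proc \<mu> F T.
        ae_dt_prob \<mu> T (\<lambda>t \<omega>. a1 t \<omega> \<le> u t \<omega> \<and> u t \<omega> \<le> a2 t \<omega> \<and>
          a3 t \<omega> \<le> inventory X0 u t \<omega> \<and> inventory X0 u t \<omega> \<le> a4 t \<omega>)}"

text \<open>The infimum is taken in \<open>ereal\<close> because the real-valued \<open>Inf\<close> is unspecified on sets not bounded below.\<close>

definition minimizer_on :: "('u \<Rightarrow> real) \<Rightarrow> 'u set \<Rightarrow> 'u \<Rightarrow> bool" where
  "minimizer_on J U u \<longleftrightarrow> u \<in> U \<and> ereal (J u) = (INF v\<in>U. ereal (J v))"

end

theory Submission
  imports Defs
begin

text \<open>
  Conditioning turns \<open>E[\<integral> S\<^sub>t w\<^sub>t dt - S\<^sub>T \<integral> w\<^sub>t dt]\<close> into \<open>- E[\<integral> \<alpha>\<^sub>t w\<^sub>t dt]\<close> for every control \<open>w\<close>, so the cost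
  is a quadratic functional whose second-order part is at least \<open>1/2 E[\<integral> h\<^sub>t\<^sup>2 dt]\<close> by positivity of the
  kernel.  The Fredholm equation says that its derivative at \<open>u\<close> in the direction \<open>h = v - u\<close> is
  \<open>E[\<integral> \<phi>\<^sub>t h\<^sub>t dt]\<close>.  By Fubini, the tail integral in \<open>\<phi>\<close> pairs \<open>l3 - l4\<close> with the difference of the
  inventories, and complementary slackness makes the derivative non-negative.  Hence
  \<open>J v \<ge> J u + 1/2 E[\<integral> (v\<^sub>t - u\<^sub>t)\<^sup>2 dt]\<close> on \<open>U\<close>, which gives minimality and uniqueness.
\<close>

text \<open>The obstacle is integrability rather than algebra. The conditional expectations
  \<alpha>, \<psi> and \<open>V\<close> are given only as measurable versions that agree with
  \<open>real_cond_exp\<close> at almost every time, with no integrability in time assumed, while a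
  Bochner integral that does not exist silently has the value 0. Every product integral is therefore
  shown to exist before it is split or swapped. This works because all directions
  \<open>v - u\<close> are essentially bounded and adapted: paired with such a test process, a
  conditional expectation inherits integrability from the conditioned variable, since conditioning
  contracts the L1 norm.

  Adaptedness also explains the form of the Fredholm equation. \<open>K\<close> is not symmetric, so
  the derivative of the quadratic kernel term contains the adjoint, which carries
  \<open>K s t\<close> for \<open>s > t\<close> and looks into the future. A direction known at time
  t sees only the conditional expectation of that term given the information at t.\<close>

section \<open>Testing conditional expectations; transfer of integrals through sections\<close>

text \<open>The third claim is the L1 contraction property weighted with \<open>h\<close>; it later
  supplies integrability over time. \<open>Y\<close> is measurable for \<open>M\<close> but perhaps
  not for \<open>G\<close>, as happens for sections of a jointly measurable field.\<close>

lemma real_cond_exp_test: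
  fixes h Y Z :: "'a \<Rightarrow> real"
  assumes G: "sigma_finite_subalgebra M G"
    and h: "h \<in> borel_measurable G" "AE x in M. \<bar>h x\<bar> \<le> C"
    and Z: "integrable M Z"
    and Y: "Y \<in> borel_measurable M" "AE x in M. Y x = real_cond_exp M G Z x"
  shows "integrable M (\<lambda>x. h x * Y x)"
    and "(\<integral>x. h x * Y x \<partial>M) = (\<integral>x. h x * Z x \<partial>M)"
    and "(\<integral>x. \<bar>h x * Y x\<bar> \<partial>M) \<le> (\<integral>x. C * \<bar>Z x\<bar> \<partial>M)"
proof -
  interpret sigma_finite_subalgebra M G by (fact G)
  have [measurable]: "h \<in> borel_measurable M" "Z \<in> borel_measurable M" "Y \<in> borel_measurable M"
    using measurable_from_subalg[OF subalg h(1)] Z Y by auto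
  have test: "integrable M (\<lambda>x. g x * real_cond_exp M G Z x)"
    "(\<integral>x. g x * real_cond_exp M G Z x \<partial>M) = (\<integral>x. g x * Z x \<partial>M)"
    "integrable M (\<lambda>x. g x * Z x)"
    if g: "g \<in> borel_measurable G" "AE x in M. \<bar>g x\<bar> \<le> C" for g
  proof -
    have [measurable]: "g \<in> borel_measurable M"
      using measurable_from_subalg[OF subalg g(1)] .
    show int: "integrable M (\<lambda>x. g x * Z x)"
      by (rule Bochner_Integration.integrable_bound[OF integrable_mult_right[OF Z, of C]])
        (use g(2) in \<open>auto simp: abs_mult intro!: mult_right_mono\<close>)
    show "integrable M (\<lambda>x. g x * real_cond_exp M G Z x)"
      "(\<integral>x. g x * real_cond_exp M G Z x \<partial>M) = (\<integral>x. g x * Z x \<partial>M)"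
      using real_cond_exp_intg[OF int g(1)] by auto
  qed
  have eq: "AE x in M. h x * Y x = h x * real_cond_exp M G Z x"
    using Y(2) by auto
  show "integrable M (\<lambda>x. h x * Y x)"
  proof (rule integrable_cong_AE_imp[OF test(1)[OF h]])
    show "AE x in M. h x * real_cond_exp M G Z x = h x * Y x"
      using eq by eventually_elim (rule sym)
  qed measurable
  have "(\<integral>x. h x * Y x \<partial>M) = (\<integral>x. h x * real_cond_exp M G Z x \<partial>M)"
    by (rule integral_cong_AE) (use eq in simp_all)
  with test(2)[OF h] show "(\<integral>x. h x * Y x \<partial>M) = (\<integral>x. h x * Z x \<partial>M)"
    by simp
  define g where "g x = h x * sgn (h x * real_cond_exp M G Z x)" for x
  have g_meas: "g \<in> borel_measurable G"
    unfolding g_def using h(1) by measurable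
  have g_le: "\<bar>g x\<bar> \<le> \<bar>h x\<bar>" for x
    by (simp add: g_def abs_mult sgn_if)
  have "AE x in M. \<bar>g x\<bar> \<le> C"
    using h(2)
  proof eventually_elim
    case (elim x)
    then show ?case
      using g_le[of x] by linarith
  qed
  note g = g_meas this
  have [measurable]: "g \<in> borel_measurable M"
    using measurable_from_subalg[OF subalg g(1)] .
  have "(\<integral>x. \<bar>h x * Y x\<bar> \<partial>M) = (\<integral>x. g x * real_cond_exp M G Z x \<partial>M)"
    by (rule integral_cong_AE) (use eq in \<open>auto simp: g_def sgn_if abs_if\<close>)
  also have "\<dots> = (\<integral>x. g x * Z x \<partial>M)"
    using test(2)[OF g] .
  also have "\<dots> \<le> (\<integral>x. C * \<bar>Z x\<bar> \<partial>M)"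
  proof (rule integral_mono_AE[OF test(3)[OF g]])
    show "AE x in M. g x * Z x \<le> C * \<bar>Z x\<bar>"
      using g(2)
    proof eventually_elim
      case (elim x)
      have "g x * Z x \<le> \<bar>g x\<bar> * \<bar>Z x\<bar>"
        by (metis abs_ge_self abs_mult)
      also have "\<dots> \<le> C * \<bar>Z x\<bar>"
        using elim by (intro mult_right_mono) auto
      finally show ?case .
    qed
  qed (use Z in auto)
  finally show "(\<integral>x. \<bar>h x * Y x\<bar> \<partial>M) \<le> (\<integral>x. C * \<bar>Z x\<bar> \<partial>M)" .
qed

text \<open>\<open>g\<close> and \<open>f\<close> need not be related pointwise: only their section
  integrals agree, as for a conditional expectation and the variable conditioned. That alone does
  not make \<open>g\<close> integrable on the product, so the L1 norms of its sections are dominated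
  by the section integrals of an integrable \<open>d\<close>.\<close>

lemma (in pair_sigma_finite) integral_transfer_sections:
  fixes f g d :: "'a \<Rightarrow> 'b \<Rightarrow> real"
  assumes g: "case_prod g \<in> borel_measurable (M1 \<Otimes>\<^sub>M M2)"
    and f: "integrable (M1 \<Otimes>\<^sub>M M2) (case_prod f)"
    and d: "integrable (M1 \<Otimes>\<^sub>M M2) (case_prod d)"
    and sections: "AE x in M1. integrable M2 (g x) \<and> (\<integral>y. \<bar>g x y\<bar> \<partial>M2) \<le> (\<integral>y. d x y \<partial>M2)
      \<and> (\<integral>y. g x y \<partial>M2) = (\<integral>y. f x y \<partial>M2)"
  shows "integrable (M1 \<Otimes>\<^sub>M M2) (case_prod g)"
    and "integral\<^sup>L (M1 \<Otimes>\<^sub>M M2) (case_prod g) = integral\<^sup>L (M1 \<Otimes>\<^sub>M M2) (case_prod f)"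
proof -
  note [measurable] = g
  have [measurable]: "case_prod f \<in> borel_measurable (M1 \<Otimes>\<^sub>M M2)"
    using f by auto
  show int: "integrable (M1 \<Otimes>\<^sub>M M2) (case_prod g)"
  proof (rule Fubini_integrable[OF g])
    show "integrable M1 (\<lambda>x. \<integral>y. norm (case_prod g (x, y)) \<partial>M2)"
    proof (rule Bochner_Integration.integrable_bound[OF integrable_fst[OF d]])
      show "AE x in M1. norm (\<integral>y. norm (case_prod g (x, y)) \<partial>M2) \<le> norm (\<integral>y. d x y \<partial>M2)"
        using sections by eventually_elim auto
    qed measurable
    show "AE x in M1. integrable M2 (\<lambda>y. case_prod g (x, y))"
      using sections by auto
  qed
  show "integral\<^sup>L (M1 \<Otimes>\<^sub>M M2) (case_prod g) = integral\<^sup>L (M1 \<Otimes>\<^sub>M M2) (case_prod f)"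
    unfolding integral_fst[OF int, symmetric] integral_fst[OF f, symmetric]
    by (rule integral_cong_AE) (use sections in auto)
qed

section \<open>The time interval as a finite measure space\<close>

lemma set_integral_time_measure:
  fixes f :: "real \<Rightarrow> real"
  assumes "A \<subseteq> {0..T}"
  shows "(LINT s:A|lborel. f s) = (\<integral>s. indicator A s * f s \<partial>time_measure T)"
proof -
  have "(\<integral>s. indicator A s * f s \<partial>time_measure T) = (\<integral>s. indicator {0..T} s *\<^sub>R (indicator A s * f s) \<partial>lborel)"
    unfolding time_measure_def by (rule integral_restrict_space) auto
  also have "\<dots> = (\<integral>s. indicator A s * f s \<partial>lborel)"
    by (rule Bochner_Integration.integral_cong) (use assms in \<open>auto split: split_indicator\<close>)
  finally show ?thesis
    by (simp add: set_lebesgue_integral_def)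
qed

lemma space_time_measure [simp]: "space (time_measure T) = {0..T}"
  by (simp add: time_measure_def)

lemma finite_measure_time_measure: "finite_measure (time_measure T)"
  using emeasure_compact_finite[of "{0..T}"]
  by (intro finite_measureI) (simp add: time_measure_def emeasure_restrict_space less_top)

lemma sets_time_measure: "sets (time_measure T) = sets (restrict_space borel {0..T})"
  by (auto simp: time_measure_def sets_restrict_space)

section \<open>Measurability, essential bounds and integrability on time times probability\<close>

locale filtered_space =
  fixes \<mu> :: "'w::polish_space measure" and F :: "real \<Rightarrow> 'w measure" and T :: real
  assumes usual: "usual_filtration \<mu> F T" and T_pos: "0 < T"
begin

abbreviation dt :: "real measure" where "dt \<equiv> time_measure T"

sublocale prob_space \<mu>
  using usual by (simp add: usual_filtration_def)

sublocale dt: finite_measure dt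
  by (rule finite_measure_time_measure)

sublocale dtP: pair_sigma_finite dt \<mu> ..

sublocale dtdt: pair_sigma_finite dt dt ..

abbreviation dtP :: "(real \<times> 'w) measure" where "dtP \<equiv> dt \<Otimes>\<^sub>M \<mu>"

sublocale dtP_fin: finite_measure dtP
  by (rule finite_measure_pair_measure) (unfold_locales)

lemma subalgebra_F: "t \<in> {0..T} \<Longrightarrow> subalgebra \<mu> (F t)"
  using usual by (simp add: usual_filtration_def)

lemma sigma_finite_F: "t \<in> {0..T} \<Longrightarrow> sigma_finite_subalgebra \<mu> (F t)"
  by (intro finite_measure_subalgebra_is_sigma_finite finite_measure_subalgebra.intro
      finite_measure_subalgebra_axioms.intro subalgebra_F) unfold_locales

lemma progressive_adapted:
  assumes "progressive F T f" and t: "t \<in> {0..T}"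
  shows "f t \<in> borel_measurable (F t)"
proof -
  have "(\<lambda>(s, \<omega>). f s \<omega>) \<in> borel_measurable (restrict_space borel {0..t} \<Otimes>\<^sub>M F t)"
    using assms by (simp add: progressive_def)
  from measurable_compose[OF measurable_Pair1' this, of t] show ?thesis
    using t by simp
qed

text \<open>The condition at the final time \<open>T\<close> already covers the whole interval, and
  \<open>F T\<close> is a sub-sigma-algebra of \<mu>.\<close>

lemma progressive_measurable:
  assumes "progressive F T f"
  shows "(\<lambda>(t, \<omega>). f t \<omega>) \<in> borel_measurable dtP"
proof -
  have T: "T \<in> {0..T}"
    using T_pos by simp
  have "(\<lambda>(s, \<omega>). f s \<omega>) \<in> borel_measurable (restrict_space borel {0..T} \<Otimes>\<^sub>M F T)"
    using assms T by (simp add: progressive_def)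
  moreover have "(\<lambda>(s, \<omega>). (s, \<omega>)) \<in> dtP \<rightarrow>\<^sub>M restrict_space borel {0..T} \<Otimes>\<^sub>M F T"
  proof (rule measurable_pair)
    have "id \<in> \<mu> \<rightarrow>\<^sub>M F T"
      using measurable_from_subalg[OF subalgebra_F[OF T]] subalgebra_F[OF T]
      by (auto simp: measurable_def subalgebra_def)
    from measurable_compose[OF measurable_snd this]
    show "snd \<circ> (\<lambda>(s, \<omega>). (s, \<omega>)) \<in> dtP \<rightarrow>\<^sub>M F T"
      by (simp add: comp_def)
    have "fst \<in> dtP \<rightarrow>\<^sub>M dt"
      by simp
    also have "dtP \<rightarrow>\<^sub>M dt = dtP \<rightarrow>\<^sub>M restrict_space borel {0..T}"
      by (rule measurable_cong_sets) (simp_all add: sets_time_measure)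
    finally show "fst \<circ> (\<lambda>(s, \<omega>). (s, \<omega>)) \<in> dtP \<rightarrow>\<^sub>M restrict_space borel {0..T}"
      by (simp add: comp_def)
  qed
  ultimately show ?thesis
    using measurable_compose[of "\<lambda>(s, \<omega>). (s, \<omega>)" dtP _ "\<lambda>(s, \<omega>). f s \<omega>"]
    by (simp add: case_prod_unfold)
qed

lemma Linf_proc_measurable:
  "f \<in> Linf_proc \<mu> F T \<Longrightarrow> (\<lambda>(t, \<omega>). f t \<omega>) \<in> borel_measurable dtP"
  by (simp add: Linf_proc_def progressive_measurable)

text \<open>The time-first form of the bound serves conditioning at a fixed time, the path-first
  form serves estimates along a fixed path.\<close>

lemma Linf_procE:
  assumes "f \<in> Linf_proc \<mu> F T"
  obtains C where "0 \<le> C" "AE (t, \<omega>) in dtP. \<bar>f t \<omega>\<bar> \<le> C"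
    "AE t in dt. AE \<omega> in \<mu>. \<bar>f t \<omega>\<bar> \<le> C" "AE \<omega> in \<mu>. AE t in dt. \<bar>f t \<omega>\<bar> \<le> C"
proof -
  obtain C0 where C0: "AE (t, \<omega>) in dtP. \<bar>f t \<omega>\<bar> \<le> C0"
    using assms by (auto simp: Linf_proc_def ae_dt_prob_def)
  note [measurable] = Linf_proc_measurable[OF assms]
  have 1: "AE (t, \<omega>) in dtP. \<bar>f t \<omega>\<bar> \<le> \<bar>C0\<bar>"
    using C0 by eventually_elim auto
  have 2: "AE t in dt. AE \<omega> in \<mu>. \<bar>f t \<omega>\<bar> \<le> \<bar>C0\<bar>"
    using dtP.AE_pair[OF 1] by simp
  have 3: "AE \<omega> in \<mu>. AE t in dt. \<bar>f t \<omega>\<bar> \<le> \<bar>C0\<bar>"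
    by (rule dtP.AE_commute[THEN iffD1, OF _ 2]) measurable
  show ?thesis
    using that[OF _ 1 2 3] by simp
qed

text \<open>\<open>dtP\<close> is finite, and \<open>x \<le> 1 + x powr p\<close> for nonnegative
  \<open>x\<close>: the constant covers \<open>x \<le> 1\<close>, the power covers larger
  \<open>x\<close> because \<open>1 \<le> p\<close>.\<close>

lemma Lp_proc_integrable:
  assumes f: "f \<in> Lp_proc \<mu> F T p" and p: "1 \<le> p"
  shows "integrable dtP (\<lambda>(t, \<omega>). f t \<omega>)"
proof (rule integrableI_bounded)
  show m [measurable]: "(\<lambda>(t, \<omega>). f t \<omega>) \<in> borel_measurable dtP"
    using f by (simp add: Lp_proc_def progressive_measurable)
  have le: "x \<le> 1 + x powr p" if "0 \<le> x" for x :: real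
  proof (cases "x \<le> 1")
    case False
    then have "x powr 1 \<le> x powr p"
      using p by (intro powr_mono) auto
    then show ?thesis
      using False by simp
  qed (use that in \<open>simp add: add_increasing2\<close>)
  have "(\<integral>\<^sup>+z. ennreal (norm (case z of (t, \<omega>) \<Rightarrow> f t \<omega>)) \<partial>dtP)
      \<le> (\<integral>\<^sup>+z. 1 + ennreal (case z of (t, \<omega>) \<Rightarrow> \<bar>f t \<omega>\<bar> powr p) \<partial>dtP)"
    by (rule nn_integral_mono)
      (auto simp: ennreal_1[symmetric] ennreal_plus[symmetric] simp del: ennreal_1 ennreal_plus
        intro!: ennreal_leI le split: prod.split)
  also have "\<dots> = emeasure dtP (space dtP) + (\<integral>\<^sup>+z. ennreal (case z of (t, \<omega>) \<Rightarrow> \<bar>f t \<omega>\<bar> powr p) \<partial>dtP)"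
    by (subst nn_integral_add) auto
  also have "(\<integral>\<^sup>+z. ennreal (case z of (t, \<omega>) \<Rightarrow> \<bar>f t \<omega>\<bar> powr p) \<partial>dtP)
      = (\<integral>\<^sup>+t. \<integral>\<^sup>+\<omega>. ennreal (\<bar>f t \<omega>\<bar> powr p) \<partial>\<mu> \<partial>dt)"
    by (subst nn_integral_fst[symmetric]) auto
  also have "emeasure dtP (space dtP) + \<dots> < \<infinity>"
    using f dtP_fin.emeasure_finite[of "space dtP"] by (simp add: Lp_proc_def less_top[symmetric])
  finally show "(\<integral>\<^sup>+z. ennreal (norm (case z of (t, \<omega>) \<Rightarrow> f t \<omega>)) \<partial>dtP) < \<infinity>" .
qed

lemma AE_dtP_fst:
  assumes "AE t in dt. Q t"
  shows "AE (t, \<omega>) in dtP. Q t"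
proof -
  obtain N where N: "N \<in> null_sets dt" "{t \<in> space dt. \<not> Q t} \<subseteq> N"
    using assms by (auto simp: eventually_ae_filter)
  have "N \<times> space \<mu> \<in> null_sets dtP"
    using N(1) by (simp add: times_in_null_sets1)
  then show ?thesis
    by (rule AE_I') (use N(2) in \<open>auto simp: space_pair_measure\<close>)
qed

lemma AE_dtP_snd:
  assumes "AE \<omega> in \<mu>. Q \<omega>"
  shows "AE (t, \<omega>) in dtP. Q \<omega>"
proof -
  obtain N where N: "N \<in> null_sets \<mu>" "{\<omega> \<in> space \<mu>. \<not> Q \<omega>} \<subseteq> N"
    using assms by (auto simp: eventually_ae_filter)
  have "space dt \<times> N \<in> null_sets dtP"
    using N(1) sets.top[of dt] by (intro times_in_null_sets2) auto
  then show ?thesis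
    by (rule AE_I') (use N(2) in \<open>auto simp: space_pair_measure\<close>)
qed

lemma integrable_dtP_fst:
  fixes k :: "real \<Rightarrow> real"
  assumes k: "integrable dt k"
  shows "integrable dtP (\<lambda>(t, \<omega>). k t)"
proof (rule dtP.Fubini_integrable)
  have [measurable]: "k \<in> borel_measurable dt"
    using k by auto
  show "(\<lambda>(t, \<omega>). k t) \<in> borel_measurable dtP"
    by measurable
qed (use k in \<open>auto simp: prob_space\<close>)

lemma integrable_dtP_snd:
  fixes X :: "'w \<Rightarrow> real"
  assumes X: "integrable \<mu> X"
  shows "integrable dtP (\<lambda>(t, \<omega>). X \<omega>)"
proof (rule dtP.Fubini_integrable)
  have [measurable]: "X \<in> borel_measurable \<mu>"
    using X by auto
  show "(\<lambda>(t, \<omega>). X \<omega>) \<in> borel_measurable dtP"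
    by measurable
qed (use X in auto)

text \<open>\<open>h\<close> is not asked to be progressive: it will also be an inventory, or a
  control frozen at a fixed time, for which joint measurability and a bound are what is at
  hand.\<close>

lemma integrable_bounded_mult:
  assumes h: "(\<lambda>(t, \<omega>). h t \<omega>) \<in> borel_measurable dtP"
    and C: "AE (t, \<omega>) in dtP. \<bar>h t \<omega>\<bar> \<le> C"
    and f: "integrable dtP (\<lambda>(t, \<omega>). f t \<omega>)"
  shows "integrable dtP (\<lambda>(t, \<omega>). h t \<omega> * f t \<omega> :: real)"
proof (rule Bochner_Integration.integrable_bound[OF integrable_mult_right[OF f, of C]])
  show "AE z in dtP. norm (case z of (t, \<omega>) \<Rightarrow> h t \<omega> * f t \<omega>)
      \<le> norm (C * (case z of (t, \<omega>) \<Rightarrow> f t \<omega>))"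
    using C
  proof eventually_elim
    case (elim z)
    then show ?case
      by (cases z) (auto simp: abs_mult intro!: mult_right_mono)
  qed
  note [measurable] = h
  have [measurable]: "(\<lambda>(t, \<omega>). f t \<omega>) \<in> borel_measurable dtP"
    using f by auto
  show "(\<lambda>(t, \<omega>). h t \<omega> * f t \<omega>) \<in> borel_measurable dtP"
    by measurable
qed

lemma integrable_Linf_mult:
  assumes h: "h \<in> Linf_proc \<mu> F T" and f: "integrable dtP (\<lambda>(t, \<omega>). f t \<omega>)"
  shows "integrable dtP (\<lambda>(t, \<omega>). h t \<omega> * f t \<omega>)"
  using Linf_procE[OF h] integrable_bounded_mult[OF Linf_proc_measurable[OF h] _ f] by blast

lemma Linf_proc_integrable:
  assumes "h \<in> Linf_proc \<mu> F T"
  shows "integrable dtP (\<lambda>(t, \<omega>). h t \<omega>)"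
  using integrable_Linf_mult[OF assms, of "\<lambda>t \<omega>. 1"] by (simp add: case_prod_unfold)

lemma Linf_proc_diff:
  assumes f: "f \<in> Linf_proc \<mu> F T" and g: "g \<in> Linf_proc \<mu> F T"
  shows "(\<lambda>t \<omega>. f t \<omega> - g t \<omega>) \<in> Linf_proc \<mu> F T"
proof -
  obtain C D where C: "AE (t, \<omega>) in dtP. \<bar>f t \<omega>\<bar> \<le> C" and D: "AE (t, \<omega>) in dtP. \<bar>g t \<omega>\<bar> \<le> D"
    using Linf_procE[OF f] Linf_procE[OF g] by metis
  have "AE (t, \<omega>) in dtP. \<bar>f t \<omega> - g t \<omega>\<bar> \<le> C + D"
    using C D by eventually_elim auto
  moreover have "progressive F T (\<lambda>t \<omega>. f t \<omega> - g t \<omega>)"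
    using f g by (auto simp: Linf_proc_def progressive_def case_prod_unfold intro!: borel_measurable_diff)
  ultimately show ?thesis
    by (auto simp: Linf_proc_def ae_dt_prob_def)
qed

section \<open>Conditional expectation processes against bounded adapted tests\<close>

text \<open>Nothing is known beforehand about the size of \<open>Y\<close>. At almost every
  \<open>t\<close> the section \<open>h t\<close> is a bounded \<open>F t\<close>-measurable test
  variable, and the contraction bound integrates over time. The lemma serves the martingale,
  \<alpha> and \<psi> alike.\<close>

lemma cond_exp_process_test:
  assumes h: "h \<in> Linf_proc \<mu> F T"
    and Z: "integrable dtP (\<lambda>(t, \<omega>). Z t \<omega>)"
    and Y: "cond_exp_process \<mu> F T Z Y"
  shows "integrable dtP (\<lambda>(t, \<omega>). h t \<omega> * Y t \<omega>)"
    and "(\<integral>(t, \<omega>). h t \<omega> * Y t \<omega> \<partial>dtP) = (\<integral>(t, \<omega>). h t \<omega> * Z t \<omega> \<partial>dtP)"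
proof -
  obtain C where C: "AE t in dt. AE \<omega> in \<mu>. \<bar>h t \<omega>\<bar> \<le> C"
    using Linf_procE[OF h] by blast
  have Y_prog: "progressive F T Y"
    and Y_eq: "AE t in dt. AE \<omega> in \<mu>. Y t \<omega> = real_cond_exp \<mu> (F t) (Z t) \<omega>"
    using Y by (auto simp: cond_exp_process_def)
  note [measurable] = Linf_proc_measurable[OF h] progressive_measurable[OF Y_prog]
  have h_prog: "progressive F T h"
    using h by (simp add: Linf_proc_def)
  have d: "integrable dtP (\<lambda>(t, \<omega>). C * \<bar>Z t \<omega>\<bar>)"
    using integrable_mult_right[OF integrable_abs[OF Z], of C] by (simp add: case_prod_unfold)
  have "AE t in dt. integrable \<mu> (\<lambda>\<omega>. h t \<omega> * Y t \<omega>)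
      \<and> (\<integral>\<omega>. \<bar>h t \<omega> * Y t \<omega>\<bar> \<partial>\<mu>) \<le> (\<integral>\<omega>. C * \<bar>Z t \<omega>\<bar> \<partial>\<mu>)
      \<and> (\<integral>\<omega>. h t \<omega> * Y t \<omega> \<partial>\<mu>) = (\<integral>\<omega>. h t \<omega> * Z t \<omega> \<partial>\<mu>)"
    using C Y_eq dtP.AE_integrable_fst[OF Z] AE_space
  proof eventually_elim
    case (elim t)
    then have t: "t \<in> {0..T}"
      by simp
    have "Y t \<in> borel_measurable \<mu>"
      using measurable_from_subalg[OF subalgebra_F[OF t] progressive_adapted[OF Y_prog t]] .
    then show ?case
      using real_cond_exp_test[OF sigma_finite_F[OF t] progressive_adapted[OF h_prog t]] elim
      by blast
  qed
  from dtP.integral_transfer_sections[OF _ integrable_Linf_mult[OF h Z] d this]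
  show "integrable dtP (\<lambda>(t, \<omega>). h t \<omega> * Y t \<omega>)"
    "(\<integral>(t, \<omega>). h t \<omega> * Y t \<omega> \<partial>dtP) = (\<integral>(t, \<omega>). h t \<omega> * Z t \<omega> \<partial>dtP)"
    by auto
qed

section \<open>Kernel operators acting on bounded controls\<close>

text \<open>The two time integrals are exchanged path by path; the integrability over
  \<open>dtP\<close> serves to pass between the product integral and its iterated form. Keeping
  \<open>f\<close> and \<open>g\<close> general allows \<open>g\<close> to be a multiplier that is
  merely integrable.\<close>

lemma kernel_integral_swap:
  fixes k :: "real \<Rightarrow> real \<Rightarrow> real"
  assumes k: "AE \<omega> in \<mu>. integrable (dt \<Otimes>\<^sub>M dt) (\<lambda>(t, s). k t s * f t \<omega> * g s \<omega>)"
    and 1: "integrable dtP (\<lambda>(t, \<omega>). f t \<omega> * (\<integral>s. k t s * g s \<omega> \<partial>dt))"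
    and 2: "integrable dtP (\<lambda>(s, \<omega>). g s \<omega> * (\<integral>t. k t s * f t \<omega> \<partial>dt))"
  shows "(\<integral>(t, \<omega>). f t \<omega> * (\<integral>s. k t s * g s \<omega> \<partial>dt) \<partial>dtP)
    = (\<integral>(s, \<omega>). g s \<omega> * (\<integral>t. k t s * f t \<omega> \<partial>dt) \<partial>dtP)"
proof -
  have "(\<integral>\<omega>. (\<integral>t. f t \<omega> * (\<integral>s. k t s * g s \<omega> \<partial>dt) \<partial>dt) \<partial>\<mu>)
      = (\<integral>\<omega>. (\<integral>s. g s \<omega> * (\<integral>t. k t s * f t \<omega> \<partial>dt) \<partial>dt) \<partial>\<mu>)"
  proof (rule integral_cong_AE)
    show "AE \<omega> in \<mu>. (\<integral>t. f t \<omega> * (\<integral>s. k t s * g s \<omega> \<partial>dt) \<partial>dt)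
        = (\<integral>s. g s \<omega> * (\<integral>t. k t s * f t \<omega> \<partial>dt) \<partial>dt)"
      using k
    proof eventually_elim
      case (elim \<omega>)
      \<comment> \<open>Moving the factor inside needs no integrability: if the section is not
        integrable, both sides are 0, by the default value of the integral or because the factor
        vanishes.\<close>
      have "(\<integral>t. f t \<omega> * (\<integral>s. k t s * g s \<omega> \<partial>dt) \<partial>dt) = (\<integral>t. (\<integral>s. k t s * f t \<omega> * g s \<omega> \<partial>dt) \<partial>dt)"
        by (subst integral_mult_right_zero[symmetric]) (simp add: ac_simps)
      also have "\<dots> = (\<integral>s. (\<integral>t. k t s * f t \<omega> * g s \<omega> \<partial>dt) \<partial>dt)"
        using dtdt.Fubini_integral[OF elim] by simp
      also have "\<dots> = (\<integral>s. g s \<omega> * (\<integral>t. k t s * f t \<omega> \<partial>dt) \<partial>dt)"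
        by (subst integral_mult_right_zero[symmetric]) (simp add: ac_simps)
      finally show ?case .
    qed
  qed (use dtP.integrable_snd[OF 1] dtP.integrable_snd[OF 2] in auto)
  then show ?thesis
    unfolding dtP.integral_snd[OF 1] dtP.integral_snd[OF 2] .
qed

lemma kernel_measurable:
  fixes k :: "real \<Rightarrow> real \<Rightarrow> real"
  assumes [measurable]: "(\<lambda>(t, s). k t s) \<in> borel_measurable (dt \<Otimes>\<^sub>M dt)"
    "(\<lambda>(t, \<omega>). f t \<omega>) \<in> borel_measurable dtP"
  shows "(\<lambda>(t, \<omega>). \<integral>s. k t s * f s \<omega> \<partial>dt) \<in> borel_measurable dtP"
  by measurable

lemma kernel_section_integrable:
  fixes k :: "real \<Rightarrow> real \<Rightarrow> real"
  assumes k: "integrable (dt \<Otimes>\<^sub>M dt) (\<lambda>(t, s). k t s)" and f: "f \<in> Linf_proc \<mu> F T"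
  shows "AE (t, \<omega>) in dtP. integrable dt (\<lambda>s. k t s * f s \<omega>)"
proof -
  obtain C where C: "AE \<omega> in \<mu>. AE t in dt. \<bar>f t \<omega>\<bar> \<le> C"
    using Linf_procE[OF f] by metis
  note [measurable] = Linf_proc_measurable[OF f]
  have C': "AE \<omega> in \<mu>. (\<lambda>s. f s \<omega>) \<in> borel_measurable dt \<and> (AE s in dt. \<bar>f s \<omega>\<bar> \<le> C)"
    using C AE_space by eventually_elim auto
  show ?thesis
    using AE_dtP_fst[OF dtdt.AE_integrable_fst[OF k]] AE_dtP_snd[OF C']
  proof (eventually_elim, clarify)
    fix t \<omega> assume k: "integrable dt (k t)"
      and [measurable]: "(\<lambda>s. f s \<omega>) \<in> borel_measurable dt" and f: "AE s in dt. \<bar>f s \<omega>\<bar> \<le> C"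
    have [measurable]: "k t \<in> borel_measurable dt"
      using k by auto
    show "integrable dt (\<lambda>s. k t s * f s \<omega>)"
    proof (rule Bochner_Integration.integrable_bound[OF integrable_mult_right[OF k, of C]])
      show "AE s in dt. norm (k t s * f s \<omega>) \<le> norm (C * k t s)"
        using f by eventually_elim (subst mult.commute, simp add: abs_mult mult_right_mono)
    qed measurable
  qed
qed

text \<open>Linearity is available only where both sections are integrable, because elsewhere an
  integral may take its default value 0. Hence the statement is almost everywhere.\<close>

lemma kernel_diff:
  fixes k :: "real \<Rightarrow> real \<Rightarrow> real"
  assumes k: "integrable (dt \<Otimes>\<^sub>M dt) (\<lambda>(t, s). k t s)"
    and f: "f \<in> Linf_proc \<mu> F T" and g: "g \<in> Linf_proc \<mu> F T"
  shows "AE (t, \<omega>) in dtP. (\<integral>s. k t s * (f s \<omega> - g s \<omega>) \<partial>dt)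
    = (\<integral>s. k t s * f s \<omega> \<partial>dt) - (\<integral>s. k t s * g s \<omega> \<partial>dt)"
  using kernel_section_integrable[OF k f] kernel_section_integrable[OF k g]
  by eventually_elim (auto simp: right_diff_distrib)

text \<open>The bound does not depend on the path, so integrability over \<open>dtP\<close> reduces
  to integrability of a function of time.\<close>

lemma kernel_bound:
  fixes k :: "real \<Rightarrow> real \<Rightarrow> real"
  assumes k: "integrable (dt \<Otimes>\<^sub>M dt) (\<lambda>(t, s). k t s)" and f: "f \<in> Linf_proc \<mu> F T"
  obtains C where "0 \<le> C" "AE (t, \<omega>) in dtP. \<bar>\<integral>s. k t s * f s \<omega> \<partial>dt\<bar> \<le> C * (\<integral>s. \<bar>k t s\<bar> \<partial>dt)"
proof -
  obtain C where C0: "0 \<le> C" and C: "AE \<omega> in \<mu>. AE t in dt. \<bar>f t \<omega>\<bar> \<le> C"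
    using Linf_procE[OF f] by metis
  have "AE (t, \<omega>) in dtP. \<bar>\<integral>s. k t s * f s \<omega> \<partial>dt\<bar> \<le> C * (\<integral>s. \<bar>k t s\<bar> \<partial>dt)"
    using AE_dtP_fst[OF dtdt.AE_integrable_fst[OF k]] AE_dtP_snd[OF C]
  proof (eventually_elim, clarify)
    fix t \<omega> assume k: "integrable dt (k t)" and f: "AE s in dt. \<bar>f s \<omega>\<bar> \<le> C"
    have "\<bar>\<integral>s. k t s * f s \<omega> \<partial>dt\<bar> \<le> (\<integral>s. \<bar>k t s * f s \<omega>\<bar> \<partial>dt)"
      by (rule integral_abs_bound)
    also have "\<dots> \<le> (\<integral>s. C * \<bar>k t s\<bar> \<partial>dt)"
    proof (rule integral_mono_AE')
      show "AE s in dt. \<bar>k t s * f s \<omega>\<bar> \<le> C * \<bar>k t s\<bar>"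
        using f by eventually_elim (subst mult.commute, simp add: abs_mult mult_right_mono)
    qed (use k C0 in auto)
    finally show "\<bar>\<integral>s. k t s * f s \<omega> \<partial>dt\<bar> \<le> C * (\<integral>s. \<bar>k t s\<bar> \<partial>dt)"
      by simp
  qed
  with that C0 show ?thesis
    by blast
qed

lemma kernel_integrable:
  fixes k :: "real \<Rightarrow> real \<Rightarrow> real"
  assumes k: "integrable (dt \<Otimes>\<^sub>M dt) (\<lambda>(t, s). k t s)"
    and f: "f \<in> Linf_proc \<mu> F T" and h: "h \<in> Linf_proc \<mu> F T"
  shows "integrable dtP (\<lambda>(t, \<omega>). h t \<omega> * (\<integral>s. k t s * f s \<omega> \<partial>dt))"
proof (rule integrable_Linf_mult[OF h])
  obtain C where "0 \<le> C"
    and C: "AE (t, \<omega>) in dtP. \<bar>\<integral>s. k t s * f s \<omega> \<partial>dt\<bar> \<le> C * (\<integral>s. \<bar>k t s\<bar> \<partial>dt)"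
    using kernel_bound[OF k f] .
  have "integrable dt (\<lambda>t. \<integral>s. \<bar>k t s\<bar> \<partial>dt)"
    using dtdt.integrable_fst'[OF integrable_abs[OF k]] by simp
  from integrable_dtP_fst[OF integrable_mult_right[OF this, of C]]
  show "integrable dtP (\<lambda>(t, \<omega>). \<integral>s. k t s * f s \<omega> \<partial>dt)"
  proof (rule Bochner_Integration.integrable_bound)
    show "(\<lambda>(t, \<omega>). \<integral>s. k t s * f s \<omega> \<partial>dt) \<in> borel_measurable dtP"
      using k Linf_proc_measurable[OF f] by (intro kernel_measurable) auto
    show "AE z in dtP. norm (case z of (t, \<omega>) \<Rightarrow> \<integral>s. k t s * f s \<omega> \<partial>dt)
        \<le> norm (case z of (t, \<omega>) \<Rightarrow> C * (\<integral>s. \<bar>k t s\<bar> \<partial>dt))"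
      using C
    proof eventually_elim
      case (elim z)
      then show ?case
        by (cases z) auto
    qed
  qed
qed

text \<open>This is the Fubini hypothesis of \<open>kernel_integral_swap\<close> for two bounded
  controls: along almost every path a multiple of \<open>k\<close> dominates.\<close>

lemma kernel_triple_integrable:
  fixes k :: "real \<Rightarrow> real \<Rightarrow> real"
  assumes k: "integrable (dt \<Otimes>\<^sub>M dt) (\<lambda>(t, s). k t s)"
    and f: "f \<in> Linf_proc \<mu> F T" and g: "g \<in> Linf_proc \<mu> F T"
  shows "AE \<omega> in \<mu>. integrable (dt \<Otimes>\<^sub>M dt) (\<lambda>(t, s). k t s * f t \<omega> * g s \<omega>)"
proof -
  obtain C D where C: "AE \<omega> in \<mu>. AE t in dt. \<bar>f t \<omega>\<bar> \<le> C"
    and D: "AE \<omega> in \<mu>. AE t in dt. \<bar>g t \<omega>\<bar> \<le> D"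
    using Linf_procE[OF f] Linf_procE[OF g] by metis
  note [measurable] = Linf_proc_measurable[OF f] Linf_proc_measurable[OF g]
  have [measurable]: "(\<lambda>(t, s). k t s) \<in> borel_measurable (dt \<Otimes>\<^sub>M dt)"
    using k by auto
  show ?thesis
    using C D AE_space
  proof eventually_elim
    case (elim \<omega>)
    note [measurable] = elim(3)
    have *: "AE z in dt \<Otimes>\<^sub>M dt. \<bar>f (fst z) \<omega>\<bar> \<le> C \<and> \<bar>g (snd z) \<omega>\<bar> \<le> D"
    proof (rule dtdt.AE_pair_measure)
      show "AE t in dt. AE s in dt. \<bar>f (fst (t, s)) \<omega>\<bar> \<le> C \<and> \<bar>g (snd (t, s)) \<omega>\<bar> \<le> D"
        using elim(1) by eventually_elim (use elim(2) in simp)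
    qed measurable
    show "integrable (dt \<Otimes>\<^sub>M dt) (\<lambda>(t, s). k t s * f t \<omega> * g s \<omega>)"
    proof (rule Bochner_Integration.integrable_bound[OF integrable_mult_right[OF k, of "C * D"]])
      show "AE z in dt \<Otimes>\<^sub>M dt. norm (case z of (t, s) \<Rightarrow> k t s * f t \<omega> * g s \<omega>)
          \<le> norm (C * D * (case z of (t, s) \<Rightarrow> k t s))"
        using *
      proof eventually_elim
        case (elim z)
        then have "\<bar>f (fst z) \<omega>\<bar> * \<bar>g (snd z) \<omega>\<bar> \<le> \<bar>C\<bar> * \<bar>D\<bar>"
          by (intro mult_mono) auto
        from mult_left_mono[OF this, of "\<bar>k (fst z) (snd z)\<bar>"] show ?case
          by (simp add: case_prod_unfold abs_mult ac_simps)
      qed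
    qed measurable
  qed
qed

text \<open>Positivity of the kernel concerns deterministic functions in L2. Almost every path of
  \<open>f\<close> is essentially bounded on a finite interval and so is one of them; the inequality
  is then averaged over paths.\<close>

lemma kernel_nonneg:
  assumes K: "admissible_kernel T K" and int: "integrable (dt \<Otimes>\<^sub>M dt) (\<lambda>(t, s). K t s)"
    and f: "f \<in> Linf_proc \<mu> F T"
  shows "0 \<le> (\<integral>(t, \<omega>). f t \<omega> * (\<integral>s. K t s * f s \<omega> \<partial>dt) \<partial>dtP)"
proof -
  obtain C where "0 \<le> C" and C: "AE \<omega> in \<mu>. AE t in dt. \<bar>f t \<omega>\<bar> \<le> C"
    using Linf_procE[OF f] by metis
  note [measurable] = Linf_proc_measurable[OF f]
  have "AE \<omega> in \<mu>. 0 \<le> (\<integral>t. f t \<omega> * (\<integral>s. K t s * f s \<omega> \<partial>dt) \<partial>dt)"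
    using C AE_space
  proof eventually_elim
    case (elim \<omega>)
    note [measurable] = elim(2)
    have "(\<integral>\<^sup>+t. ennreal ((f t \<omega>)\<^sup>2) \<partial>dt) \<le> (\<integral>\<^sup>+t. ennreal (C\<^sup>2) \<partial>dt)"
    proof (rule nn_integral_mono_AE)
      show "AE t in dt. ennreal ((f t \<omega>)\<^sup>2) \<le> ennreal (C\<^sup>2)"
        using elim(1) by eventually_elim (metis abs_ge_zero ennreal_leI power2_abs power_mono)
    qed
    also have "\<dots> < \<infinity>"
      using dt.emeasure_finite[of "space dt"] by (simp add: ennreal_mult_eq_top_iff less_top[symmetric])
    finally have "(\<lambda>t. f t \<omega>) \<in> L2_fun T"
      by (simp add: L2_fun_def)
    then have "0 \<le> (\<integral>t. (\<integral>s. K t s * f s \<omega> * f t \<omega> \<partial>dt) \<partial>dt)"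
      using K by (simp add: admissible_kernel_def)
    then show ?case
      by (simp add: mult.commute)
  qed
  then have "0 \<le> (\<integral>\<omega>. (\<integral>t. f t \<omega> * (\<integral>s. K t s * f s \<omega> \<partial>dt) \<partial>dt) \<partial>\<mu>)"
    by (rule integral_nonneg_AE)
  then show ?thesis
    unfolding dtP.integral_snd[OF kernel_integrable[OF int f f]] .
qed

section \<open>Kernel integrals of the two-parameter conditional expectation\<close>

lemma cond_exp_field_kernel_measurable:
  fixes k :: "real \<Rightarrow> real \<Rightarrow> real"
  assumes [measurable]: "(\<lambda>(t, s). k t s) \<in> borel_measurable (dt \<Otimes>\<^sub>M dt)"
    and V: "cond_exp_field \<mu> F T u V" and t [measurable]: "t \<in> space dt"
  shows "(\<lambda>\<omega>. \<integral>s. k t s * V t s \<omega> \<partial>dt) \<in> borel_measurable \<mu>"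
proof -
  have V_meas: "(\<lambda>(t, s, \<omega>). V t s \<omega>) \<in> borel_measurable (dt \<Otimes>\<^sub>M dtP)"
    using V by (simp add: cond_exp_field_def)
  have [measurable]: "(\<lambda>(s, \<omega>). V t s \<omega>) \<in> borel_measurable dtP"
    using measurable_compose[OF measurable_Pair1'[OF t] V_meas] by (simp add: case_prod_unfold)
  show ?thesis
    by measurable
qed

text \<open>
  The version of \<open>E\<^sub>t[u\<^sub>s]\<close> chosen by \<open>real_cond_exp\<close> need not be jointly measurable in \<open>(t, s)\<close>, so the
  comparison is made for fixed \<open>t\<close> instead of on the triple product.
\<close>

lemma cond_exp_field_test:
  fixes k :: "real \<Rightarrow> real \<Rightarrow> real"
  assumes k: "integrable (dt \<Otimes>\<^sub>M dt) (\<lambda>(t, s). k t s)"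
    and h: "h \<in> Linf_proc \<mu> F T" and u: "u \<in> Linf_proc \<mu> F T"
    and V: "cond_exp_field \<mu> F T u V"
  shows "AE t in dt. (\<integral>\<omega>. h t \<omega> * (\<integral>s. k t s * V t s \<omega> \<partial>dt) \<partial>\<mu>)
    = (\<integral>\<omega>. h t \<omega> * (\<integral>s. k t s * u s \<omega> \<partial>dt) \<partial>\<mu>)"
proof -
  obtain C where "0 \<le> C" and C: "AE t in dt. AE \<omega> in \<mu>. \<bar>h t \<omega>\<bar> \<le> C"
    using Linf_procE[OF h] by metis
  have V_meas: "(\<lambda>(t, s, \<omega>). V t s \<omega>) \<in> borel_measurable (dt \<Otimes>\<^sub>M dtP)"
    and V_eq: "AE t in dt. AE s in dt. AE \<omega> in \<mu>. V t s \<omega> = real_cond_exp \<mu> (F t) (u s) \<omega>"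
    using V by (auto simp: cond_exp_field_def)
  have [measurable]: "(\<lambda>(t, s). k t s) \<in> borel_measurable (dt \<Otimes>\<^sub>M dt)"
    using k by auto
  note [measurable] = Linf_proc_measurable[OF h] Linf_proc_measurable[OF u]
  have h_prog: "progressive F T h"
    using h by (simp add: Linf_proc_def)
  note u_int = Linf_proc_integrable[OF u]
  show ?thesis
    using C V_eq dtdt.AE_integrable_fst[OF k] AE_space
  proof eventually_elim
    case (elim t)
    then have t [measurable]: "t \<in> space dt" and t': "t \<in> {0..T}"
      by auto
    have h_t [measurable]: "h t \<in> borel_measurable \<mu>"
      by measurable
    have [measurable]: "(\<lambda>(s, \<omega>). V t s \<omega>) \<in> borel_measurable dtP"
      using measurable_compose[OF measurable_Pair1'[OF t] V_meas] by (simp add: case_prod_unfold)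
    have ku: "integrable dtP (\<lambda>(s, \<omega>). u s \<omega> * k t s)"
      using integrable_Linf_mult[OF u integrable_dtP_fst[OF elim(3)]] .
    have f: "integrable dtP (\<lambda>(s, \<omega>). h t \<omega> * k t s * u s \<omega>)"
    proof -
      have "integrable dtP (\<lambda>(s, \<omega>). h t \<omega> * (u s \<omega> * k t s))"
        by (rule integrable_bounded_mult[OF _ AE_dtP_snd[OF elim(1)] ku]) measurable
      then show ?thesis
        by (simp add: ac_simps)
    qed
    \<comment> \<open>With \<open>t\<close> fixed, \<open>s\<close> becomes the outer variable of
      \<open>integral_transfer_sections\<close> and this is its dominating function.\<close>
    have d: "integrable dtP (\<lambda>(s, \<omega>). C * \<bar>k t s\<bar> * \<bar>u s \<omega>\<bar>)"
      using integrable_mult_right[OF integrable_abs[OF ku], of C]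
      by (simp add: case_prod_unfold abs_mult ac_simps)
    have "AE s in dt. integrable \<mu> (\<lambda>\<omega>. h t \<omega> * k t s * V t s \<omega>)
        \<and> (\<integral>\<omega>. \<bar>h t \<omega> * k t s * V t s \<omega>\<bar> \<partial>\<mu>) \<le> (\<integral>\<omega>. C * \<bar>k t s\<bar> * \<bar>u s \<omega>\<bar> \<partial>\<mu>)
        \<and> (\<integral>\<omega>. h t \<omega> * k t s * V t s \<omega> \<partial>\<mu>) = (\<integral>\<omega>. h t \<omega> * k t s * u s \<omega> \<partial>\<mu>)"
      using elim(2) dtP.AE_integrable_fst[OF u_int] AE_space
    proof eventually_elim
      case (elim s)
      note [measurable] = elim(3)
      \<comment> \<open>The kernel is deterministic, so for fixed \<open>t\<close> and
        \<open>s\<close> it is a constant factor and the product is still a bounded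
        \<open>F t\<close>-measurable test for \<open>u s\<close>.\<close>
      have 1: "(\<lambda>\<omega>. h t \<omega> * k t s) \<in> borel_measurable (F t)"
        using progressive_adapted[OF h_prog t'] by simp
      have 2: "AE \<omega> in \<mu>. \<bar>h t \<omega> * k t s\<bar> \<le> C * \<bar>k t s\<bar>"
        using \<open>AE \<omega> in \<mu>. \<bar>h t \<omega>\<bar> \<le> C\<close> by eventually_elim (simp add: abs_mult mult_right_mono)
      have 3: "V t s \<in> borel_measurable \<mu>"
        by measurable
      show ?case
        using real_cond_exp_test[OF sigma_finite_F[OF t'] 1 2 elim(2) 3 elim(1)] by blast
    qed
    note g = dtP.integral_transfer_sections[OF _ f d this]
    have g_int: "integrable dtP (\<lambda>(s, \<omega>). h t \<omega> * k t s * V t s \<omega>)"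
      by (rule g) measurable
    have g_eq: "(\<integral>(s, \<omega>). h t \<omega> * k t s * V t s \<omega> \<partial>dtP) = (\<integral>(s, \<omega>). h t \<omega> * k t s * u s \<omega> \<partial>dtP)"
      by (rule g) measurable
    have "(\<integral>\<omega>. h t \<omega> * (\<integral>s. k t s * V t s \<omega> \<partial>dt) \<partial>\<mu>) = (\<integral>\<omega>. (\<integral>s. h t \<omega> * k t s * V t s \<omega> \<partial>dt) \<partial>\<mu>)"
      by (simp add: mult.assoc)
    also have "\<dots> = (\<integral>\<omega>. (\<integral>s. h t \<omega> * k t s * u s \<omega> \<partial>dt) \<partial>\<mu>)"
      unfolding dtP.integral_snd[OF g_int] dtP.integral_snd[OF f] by (fact g_eq)
    also have "\<dots> = (\<integral>\<omega>. h t \<omega> * (\<integral>s. k t s * u s \<omega> \<partial>dt) \<partial>\<mu>)"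
      by (simp add: mult.assoc)
    finally show ?case .
  qed
qed

section \<open>The admissible kernel and the inventory kernel\<close>

text \<open>The time square has finite measure, so square integrability implies integrability.
  Against essentially bounded controls, plain integrability is what the kernel lemmas ask
  for.\<close>

lemma admissible_kernel_integrable:
  assumes K: "admissible_kernel T K"
  shows "integrable (dt \<Otimes>\<^sub>M dt) (\<lambda>(t, s). K t s)"
proof (rule integrableI_bounded)
  show [measurable]: "(\<lambda>(t, s). K t s) \<in> borel_measurable (dt \<Otimes>\<^sub>M dt)"
    using K by (simp add: admissible_kernel_def)
  interpret fin: finite_measure "dt \<Otimes>\<^sub>M dt"
    by (rule finite_measure_pair_measure) (unfold_locales)
  have "\<bar>x\<bar> \<le> 1 + x\<^sup>2" for x :: real
    using zero_le_power2[of "\<bar>x\<bar> - 1"] by (simp add: power2_diff)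
  then have "(\<integral>\<^sup>+z. ennreal (norm (case z of (t, s) \<Rightarrow> K t s)) \<partial>(dt \<Otimes>\<^sub>M dt))
      \<le> (\<integral>\<^sup>+z. 1 + ennreal (case z of (t, s) \<Rightarrow> (K t s)\<^sup>2) \<partial>(dt \<Otimes>\<^sub>M dt))"
    by (intro nn_integral_mono)
      (auto simp: ennreal_1[symmetric] ennreal_plus[symmetric] simp del: ennreal_1 ennreal_plus
        intro!: ennreal_leI split: prod.split)
  also have "\<dots> = emeasure (dt \<Otimes>\<^sub>M dt) (space (dt \<Otimes>\<^sub>M dt))
      + (\<integral>\<^sup>+z. ennreal (case z of (t, s) \<Rightarrow> (K t s)\<^sup>2) \<partial>(dt \<Otimes>\<^sub>M dt))"
    by (subst nn_integral_add) auto
  also have "(\<integral>\<^sup>+z. ennreal (case z of (t, s) \<Rightarrow> (K t s)\<^sup>2) \<partial>(dt \<Otimes>\<^sub>M dt))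
      = (\<integral>\<^sup>+t. \<integral>\<^sup>+s. ennreal ((K t s)\<^sup>2) \<partial>dt \<partial>dt)"
    by (subst dt.nn_integral_fst[symmetric]) auto
  also have "emeasure (dt \<Otimes>\<^sub>M dt) (space (dt \<Otimes>\<^sub>M dt)) + \<dots> < \<infinity>"
    using K fin.emeasure_finite[of "space (dt \<Otimes>\<^sub>M dt)"]
    by (simp add: admissible_kernel_def less_top[symmetric])
  finally show "(\<integral>\<^sup>+z. ennreal (norm (case z of (t, s) \<Rightarrow> K t s)) \<partial>(dt \<Otimes>\<^sub>M dt)) < \<infinity>" .
qed

text \<open>Up to \<open>X0\<close>, the inventory is itself a kernel operator, with the indicator
  of \<open>s \<le> t\<close> as kernel. This brings it under the lemmas on kernels.\<close>

lemma indicator_kernel_integrable: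
  "integrable (dt \<Otimes>\<^sub>M dt) (\<lambda>(t, s). indicator {0..t} s :: real)"
proof -
  interpret fin: finite_measure "dt \<Otimes>\<^sub>M dt"
    by (rule finite_measure_pair_measure) (unfold_locales)
  have id: "(\<lambda>x. x) \<in> borel_measurable dt"
    unfolding time_measure_def by (rule measurable_restrict_space1) simp
  have [measurable]: "fst \<in> borel_measurable (dt \<Otimes>\<^sub>M dt)" "snd \<in> borel_measurable (dt \<Otimes>\<^sub>M dt)"
    by (rule measurable_compose[OF measurable_fst id], rule measurable_compose[OF measurable_snd id])
  have "integrable (dt \<Otimes>\<^sub>M dt) (\<lambda>z. if 0 \<le> snd z \<and> snd z \<le> fst z then 1 else 0 :: real)"
    by (rule fin.integrable_const_bound[where B = 1]) auto
  then show ?thesis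
    by (simp add: case_prod_unfold indicator_def of_bool_def)
qed

lemma inventory_eq:
  assumes "t \<in> {0..T}"
  shows "inventory X0 w t \<omega> = X0 + (\<integral>s. indicator {0..t} s * w s \<omega> \<partial>dt)"
  using assms by (simp add: inventory_def set_integral_time_measure)

lemma AE_dtP_time: "AE (t, \<omega>) in dtP. t \<in> {0..T}"
  by (rule AE_dtP_fst) (use AE_space[of dt] in simp)

lemma inventory_measurable:
  assumes w: "w \<in> Linf_proc \<mu> F T"
  shows "(\<lambda>(t, \<omega>). inventory X0 w t \<omega>) \<in> borel_measurable dtP"
proof -
  have [measurable]: "(\<lambda>(t, \<omega>). \<integral>s. indicator {0..t} s * w s \<omega> \<partial>dt) \<in> borel_measurable dtP"
    using indicator_kernel_integrable Linf_proc_measurable[OF w]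
    by (intro kernel_measurable) auto
  have "(\<lambda>(t, \<omega>). X0 + (\<integral>s. indicator {0..t} s * w s \<omega> \<partial>dt)) \<in> borel_measurable dtP"
    by measurable
  then show ?thesis
    by (rule measurable_cong[THEN iffD1, rotated]) (auto simp: space_pair_measure inventory_eq)
qed

lemma inventory_bounded:
  assumes w: "w \<in> Linf_proc \<mu> F T"
  obtains C where "AE (t, \<omega>) in dtP. \<bar>inventory X0 w t \<omega>\<bar> \<le> C"
proof -
  obtain C where "0 \<le> C" and C: "AE (t, \<omega>) in dtP. \<bar>\<integral>s. indicator {0..t} s * w s \<omega> \<partial>dt\<bar>
      \<le> C * (\<integral>s. \<bar>indicator {0..t} s\<bar> \<partial>dt)"
    using kernel_bound[OF indicator_kernel_integrable w] .
  have le: "(\<integral>s. \<bar>indicator {0..t} s :: real\<bar> \<partial>dt) \<le> (\<integral>s. 1 \<partial>dt)" for t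
    by (rule integral_mono_AE') (auto simp: indicator_def)
  have "AE (t, \<omega>) in dtP. \<bar>inventory X0 w t \<omega>\<bar> \<le> \<bar>X0\<bar> + C * (\<integral>s. 1 \<partial>dt)"
    using C AE_dtP_time
  proof (eventually_elim, clarify)
    fix t \<omega>
    assume *: "\<bar>\<integral>s. indicator {0..t} s * w s \<omega> \<partial>dt\<bar> \<le> C * (\<integral>s. \<bar>indicator {0..t} s\<bar> \<partial>dt)"
      and t: "t \<in> {0..T}"
    note *
    also have "C * (\<integral>s. \<bar>indicator {0..t} s\<bar> \<partial>dt) \<le> C * (\<integral>s. 1 \<partial>dt)"
      using le \<open>0 \<le> C\<close> by (rule mult_left_mono)
    finally show "\<bar>inventory X0 w t \<omega>\<bar> \<le> \<bar>X0\<bar> + C * (\<integral>s. 1 \<partial>dt)"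
      unfolding inventory_eq[OF t] by linarith
  qed
  then show ?thesis
    using that by blast
qed

section \<open>The cost as a quadratic functional\<close>

text \<open>In this form the martingale is handled by the same testing lemma as \<alpha>, which
  exchanges \<open>M t\<close> for \<open>M T\<close> inside the cost.\<close>

lemma martingale_cond_exp_process:
  assumes "square_int_martingale \<mu> F T M"
  shows "cond_exp_process \<mu> F T (\<lambda>t. M T) M"
proof -
  have "AE t in dt. AE \<omega> in \<mu>. M t \<omega> = real_cond_exp \<mu> (F t) (M T) \<omega>"
    using AE_space
  proof eventually_elim
    case (elim t)
    then have "AE \<omega> in \<mu>. real_cond_exp \<mu> (F t) (M T) \<omega> = M t \<omega>"
      using assms by (simp add: square_int_martingale_def)
    then show ?case
      by eventually_elim simp
  qed
  then show ?thesis
    using assms by (simp add: cond_exp_process_def square_int_martingale_def)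
qed

text \<open>Up to a constant independent of \<open>w\<close>, the cost becomes one integral over
  \<open>dtP\<close>, so two costs can be subtracted pointwise. Integrability of \<open>P T\<close>
  is assumed separately because membership in \<open>Lp_proc\<close> does not constrain a single
  time.\<close>

lemma cost_eq:
  assumes K: "admissible_kernel T K"
    and P: "P \<in> Lp_proc \<mu> F T 2" and P_T: "integrable \<mu> (P T)"
    and M: "square_int_martingale \<mu> F T M"
    and \<alpha>: "cond_exp_process \<mu> F T (\<lambda>t \<omega>. P T \<omega> - P t \<omega>) \<alpha>"
    and w: "w \<in> Linf_proc \<mu> F T"
  shows "integrable dtP (\<lambda>(t, \<omega>). w t \<omega> * (1/2 * w t \<omega> + (\<integral>s. K t s * w s \<omega> \<partial>dt) - \<alpha> t \<omega>))"
    and "cost \<mu> T K X0 (\<lambda>t \<omega>. P t \<omega> + M t \<omega>) w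
      = (\<integral>(t, \<omega>). w t \<omega> * (1/2 * w t \<omega> + (\<integral>s. K t s * w s \<omega> \<partial>dt) - \<alpha> t \<omega>) \<partial>dtP)
        - X0 * (\<integral>\<omega>. P T \<omega> + M T \<omega> \<partial>\<mu>)"
proof -
  have M_T: "integrable \<mu> (M T)"
  proof (rule square_integrable_imp_integrable)
    show "M T \<in> borel_measurable \<mu>"
      using M T_pos measurable_from_subalg[OF subalgebra_F, of T "M T" borel]
      by (simp add: square_int_martingale_def)
    show "integrable \<mu> (\<lambda>\<omega>. (M T \<omega>)\<^sup>2)"
      using M T_pos by (simp add: square_int_martingale_def)
  qed
  have P_int: "integrable dtP (\<lambda>(t, \<omega>). P t \<omega>)"
    using Lp_proc_integrable[OF P] by simp
  note P_T_int = integrable_dtP_snd[OF P_T] and M_T_int = integrable_dtP_snd[OF M_T]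
  have PP_int: "integrable dtP (\<lambda>(t, \<omega>). P T \<omega> - P t \<omega>)"
    using Bochner_Integration.integrable_diff[OF P_T_int P_int] by (simp add: case_prod_unfold)
  note ints = cond_exp_process_test(1)[OF w M_T_int martingale_cond_exp_process[OF M]]
    cond_exp_process_test(1)[OF w PP_int \<alpha>]
    integrable_Linf_mult[OF w P_int] integrable_Linf_mult[OF w P_T_int]
    integrable_Linf_mult[OF w M_T_int] integrable_Linf_mult[OF w Linf_proc_integrable[OF w]]
    kernel_integrable[OF admissible_kernel_integrable[OF K] w w]
  note ints' = ints[unfolded case_prod_unfold]
  have eqs: "(\<integral>z. w (fst z) (snd z) * M (fst z) (snd z) \<partial>dtP) = (\<integral>z. w (fst z) (snd z) * M T (snd z) \<partial>dtP)"
    "(\<integral>z. w (fst z) (snd z) * \<alpha> (fst z) (snd z) \<partial>dtP)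
      = (\<integral>z. w (fst z) (snd z) * P T (snd z) \<partial>dtP) - (\<integral>z. w (fst z) (snd z) * P (fst z) (snd z) \<partial>dtP)"
    using cond_exp_process_test(2)[OF w M_T_int martingale_cond_exp_process[OF M]]
      cond_exp_process_test(2)[OF w PP_int \<alpha>] ints'
    by (simp_all add: case_prod_unfold right_diff_distrib)
  define G where "G t \<omega> = (P t \<omega> + M t \<omega> + 1/2 * w t \<omega> + (\<integral>s. K t s * w s \<omega> \<partial>dt)) * w t \<omega>" for t \<omega>
  have G_int: "integrable dtP (\<lambda>(t, \<omega>). G t \<omega>)"
    unfolding G_def case_prod_unfold using ints' by (simp add: algebra_simps)
  have wS_int: "integrable dtP (\<lambda>(t, \<omega>). w t \<omega> * (P T \<omega> + M T \<omega>))"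
    unfolding case_prod_unfold using ints' by (simp add: algebra_simps)
  show "integrable dtP (\<lambda>(t, \<omega>). w t \<omega> * (1/2 * w t \<omega> + (\<integral>s. K t s * w s \<omega> \<partial>dt) - \<alpha> t \<omega>))"
    unfolding case_prod_unfold using ints' by (simp add: algebra_simps)
  \<comment> \<open>The kernel vanishes for \<open>s > t\<close>, so extending the range to the
    whole interval changes nothing.\<close>
  have kernel_eq: "(LINT s:{0..t}|lborel. K t s * w s \<omega>) = (\<integral>s. K t s * w s \<omega> \<partial>dt)"
    if "t \<in> {0..T}" for t \<omega>
  proof -
    have "(LINT s:{0..t}|lborel. K t s * w s \<omega>) = (\<integral>s. indicator {0..t} s * (K t s * w s \<omega>) \<partial>dt)"
      using that by (intro set_integral_time_measure) auto
    also have "\<dots> = (\<integral>s. K t s * w s \<omega> \<partial>dt)"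
      using that K
      by (intro Bochner_Integration.integral_cong) (auto simp: admissible_kernel_def indicator_def)
    finally show ?thesis .
  qed
  have inv: "inventory X0 w T \<omega> = X0 + (\<integral>t. w t \<omega> \<partial>dt)" for \<omega>
  proof -
    have "(\<integral>s. indicator {0..T} s * w s \<omega> \<partial>dt) = (\<integral>t. w t \<omega> \<partial>dt)"
      by (rule Bochner_Integration.integral_cong) auto
    then show ?thesis
      using T_pos by (simp add: inventory_eq)
  qed
  have "cost \<mu> T K X0 (\<lambda>t \<omega>. P t \<omega> + M t \<omega>) w
      = (\<integral>\<omega>. (\<integral>t. G t \<omega> \<partial>dt) - (X0 * (P T \<omega> + M T \<omega>) + (\<integral>t. w t \<omega> * (P T \<omega> + M T \<omega>) \<partial>dt)) \<partial>\<mu>)"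
    unfolding cost_def inv G_def
    by (intro Bochner_Integration.integral_cong arg_cong2[where f = "(-)"] refl)
      (simp_all add: kernel_eq distrib_right)
  \<comment> \<open>The terminal price does not depend on \<open>t\<close> and could leave the time
    integral. It is kept inside so that the term remains the iterated form of the product integral
    in \<open>wS_int\<close>.\<close>
  also have "\<dots> = (\<integral>(t, \<omega>). G t \<omega> \<partial>dtP)
      - (X0 * (\<integral>\<omega>. P T \<omega> + M T \<omega> \<partial>\<mu>) + (\<integral>(t, \<omega>). w t \<omega> * (P T \<omega> + M T \<omega>) \<partial>dtP))"
    using dtP.integrable_snd[OF G_int] dtP.integrable_snd[OF wS_int] P_T M_T
    by (simp add: dtP.integral_snd[OF G_int] dtP.integral_snd[OF wS_int]
        del: integral_mult_left integral_mult_left_zero)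
  also have "\<dots> = (\<integral>(t, \<omega>). w t \<omega> * (1/2 * w t \<omega> + (\<integral>s. K t s * w s \<omega> \<partial>dt) - \<alpha> t \<omega>) \<partial>dtP)
        - X0 * (\<integral>\<omega>. P T \<omega> + M T \<omega> \<partial>\<mu>)"
    unfolding case_prod_unfold G_def using ints' eqs by (simp add: algebra_simps)
  finally show "cost \<mu> T K X0 (\<lambda>t \<omega>. P t \<omega> + M t \<omega>) w
      = (\<integral>(t, \<omega>). w t \<omega> * (1/2 * w t \<omega> + (\<integral>s. K t s * w s \<omega> \<partial>dt) - \<alpha> t \<omega>) \<partial>dtP)
        - X0 * (\<integral>\<omega>. P T \<omega> + M T \<omega> \<partial>\<mu>)" .
qed

section \<open>Multipliers and complementary slackness\<close>

text \<open>\<open>p\<close> is the slack of the competitor \<open>v\<close> in one constraint and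
  \<open>q\<close> is minus the slack of \<open>u\<close> in the same constraint. The bound cancels
  in \<open>p + q\<close>, which leaves the difference of controls or of inventories. Integrability
  of \<open>q * l\<close> makes the vanishing iterated integral a statement about the product
  integral.\<close>

lemma complementary_slackness:
  assumes l: "AE (t, \<omega>) in dtP. 0 \<le> l t \<omega>" and p: "AE (t, \<omega>) in dtP. 0 \<le> p t \<omega>"
    and p_int: "integrable dtP (\<lambda>(t, \<omega>). p t \<omega> * l t \<omega>)"
    and q_int: "integrable dtP (\<lambda>(t, \<omega>). q t \<omega> * l t \<omega>)"
    and slack: "0 = (\<integral>\<omega>. (\<integral>t. q t \<omega> * l t \<omega> \<partial>dt) \<partial>\<mu>)"
  shows "integrable dtP (\<lambda>(t, \<omega>). (p t \<omega> + q t \<omega>) * l t \<omega> :: real)"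
    and "0 \<le> (\<integral>(t, \<omega>). (p t \<omega> + q t \<omega>) * l t \<omega> \<partial>dtP)"
proof -
  have "AE z in dtP. 0 \<le> (case z of (t, \<omega>) \<Rightarrow> p t \<omega> * l t \<omega>)"
    using l p by eventually_elim auto
  then have "0 \<le> (\<integral>(t, \<omega>). p t \<omega> * l t \<omega> \<partial>dtP)"
    by (rule integral_nonneg_AE)
  moreover have "(\<integral>(t, \<omega>). q t \<omega> * l t \<omega> \<partial>dtP) = 0"
    using slack dtP.integral_snd[OF q_int] by simp
  ultimately show "0 \<le> (\<integral>(t, \<omega>). (p t \<omega> + q t \<omega>) * l t \<omega> \<partial>dtP)"
    using p_int q_int by (simp add: case_prod_unfold distrib_right)
  show "integrable dtP (\<lambda>(t, \<omega>). (p t \<omega> + q t \<omega>) * l t \<omega>)"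
    using p_int q_int by (simp add: case_prod_unfold distrib_right)
qed

text \<open>The kernel lemmas above ask for bounded integrands, but \<open>l\<close> is merely
  integrable. The integrals exist because the indicator kernel is bounded by 1 and the direction
  \<open>v - u\<close> is essentially bounded.\<close>

lemma cond_exp_tail_integral_test:
  assumes l: "integrable dtP (\<lambda>(t, \<omega>). l t \<omega>)"
    and \<psi>: "cond_exp_process \<mu> F T (\<lambda>t \<omega>. LINT s:{t..T}|lborel. l s \<omega>) \<psi>"
    and u: "u \<in> Linf_proc \<mu> F T" and v: "v \<in> Linf_proc \<mu> F T"
  shows "integrable dtP (\<lambda>(t, \<omega>). (v t \<omega> - u t \<omega>) * \<psi> t \<omega>)"
    and "(\<integral>(t, \<omega>). (v t \<omega> - u t \<omega>) * \<psi> t \<omega> \<partial>dtP)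
      = (\<integral>(t, \<omega>). (inventory X0 v t \<omega> - inventory X0 u t \<omega>) * l t \<omega> \<partial>dtP)"
proof -
  define h where "h t \<omega> = v t \<omega> - u t \<omega>" for t \<omega>
  have h: "h \<in> Linf_proc \<mu> F T"
    using Linf_proc_diff[OF v u] unfolding h_def .
  \<comment> \<open>This is the transpose of the inventory kernel: \<open>k t s\<close> cuts out the
    tail \<open>t \<le> s\<close>, and \<open>k s t\<close> is the indicator of
    \<open>{0..t}\<close> at \<open>s\<close>.\<close>
  define k :: "real \<Rightarrow> real \<Rightarrow> real" where "k t s = indicator {0..s} t" for t s
  define Z where "Z t \<omega> = (\<integral>s. k t s * l s \<omega> \<partial>dt)" for t \<omega>
  have k_int: "integrable (dt \<Otimes>\<^sub>M dt) (\<lambda>(t, s). k t s)"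
    using dtdt.integrable_product_swap[OF indicator_kernel_integrable] by (simp add: k_def)
  have k_meas [measurable]: "(\<lambda>(t, s). k t s) \<in> borel_measurable (dt \<Otimes>\<^sub>M dt)"
    using k_int by auto
  have l_meas [measurable]: "(\<lambda>(t, \<omega>). l t \<omega>) \<in> borel_measurable dtP"
    using l by auto
  note [measurable] = Linf_proc_measurable[OF h]
  have k_le: "\<bar>k t s\<bar> \<le> 1" for t s
    by (simp add: k_def indicator_def)
  have Z_meas: "(\<lambda>(t, \<omega>). Z t \<omega>) \<in> borel_measurable dtP"
    unfolding Z_def by (rule kernel_measurable) measurable
  have l_section: "AE \<omega> in \<mu>. integrable dt (\<lambda>s. l s \<omega>)"
    using dtP.AE_integrable_snd[OF l] by simp
  have Z_int: "integrable dtP (\<lambda>(t, \<omega>). Z t \<omega>)"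
  proof (rule Bochner_Integration.integrable_bound[OF integrable_dtP_snd Z_meas])
    have "integrable dtP (\<lambda>(t, \<omega>). \<bar>l t \<omega>\<bar>)"
      using integrable_abs[OF l] by (simp add: case_prod_unfold)
    from dtP.integrable_snd[OF this]
    show "integrable \<mu> (\<lambda>\<omega>. \<integral>s. \<bar>l s \<omega>\<bar> \<partial>dt)" .
    show "AE z in dtP. norm (case z of (t, \<omega>) \<Rightarrow> Z t \<omega>) \<le> norm (case z of (t, \<omega>) \<Rightarrow> \<integral>s. \<bar>l s \<omega>\<bar> \<partial>dt)"
      using AE_dtP_snd[OF l_section]
    proof (eventually_elim, clarify)
      fix t \<omega> assume l: "integrable dt (\<lambda>s. l s \<omega>)"
      have "\<bar>Z t \<omega>\<bar> \<le> (\<integral>s. \<bar>k t s * l s \<omega>\<bar> \<partial>dt)"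
        unfolding Z_def by (rule integral_abs_bound)
      also have "\<dots> \<le> (\<integral>s. \<bar>l s \<omega>\<bar> \<partial>dt)"
        using l k_le by (intro integral_mono_AE') (auto simp: abs_mult mult_left_le_one_le)
      finally show "norm (Z t \<omega>) \<le> norm (\<integral>s. \<bar>l s \<omega>\<bar> \<partial>dt)"
        by simp
    qed
  qed
  have tail_eq: "(LINT s:{t..T}|lborel. l s \<omega>) = Z t \<omega>" if "t \<in> {0..T}" for t \<omega>
  proof -
    have "(LINT s:{t..T}|lborel. l s \<omega>) = (\<integral>s. indicator {t..T} s * l s \<omega> \<partial>dt)"
      using that by (intro set_integral_time_measure) auto
    also have "\<dots> = Z t \<omega>"
      unfolding Z_def k_def using that
      by (intro Bochner_Integration.integral_cong) (auto simp: indicator_def)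
    finally show ?thesis .
  qed
  have \<psi>': "cond_exp_process \<mu> F T Z \<psi>"
  proof -
    have "AE t in dt. AE \<omega> in \<mu>. \<psi> t \<omega> = real_cond_exp \<mu> (F t) (Z t) \<omega>"
      using \<psi>[unfolded cond_exp_process_def, THEN conjunct2] AE_space
      by eventually_elim (simp add: tail_eq)
    with \<psi> show ?thesis
      by (simp add: cond_exp_process_def)
  qed
  show "integrable dtP (\<lambda>(t, \<omega>). (v t \<omega> - u t \<omega>) * \<psi> t \<omega>)"
    using cond_exp_process_test(1)[OF h Z_int \<psi>'] by (simp add: h_def)
  define D where "D t \<omega> = inventory X0 v t \<omega> - inventory X0 u t \<omega>" for t \<omega>
  have D_meas: "(\<lambda>(t, \<omega>). D t \<omega>) \<in> borel_measurable dtP"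
    using inventory_measurable[OF v] inventory_measurable[OF u] by (simp add: D_def case_prod_unfold)
  \<comment> \<open>The initial inventory \<open>X0\<close> cancels, leaving the inventory kernel
    applied to \<open>h\<close>.\<close>
  have D_eq: "AE (t, \<omega>) in dtP. D t \<omega> = (\<integral>s. k s t * h s \<omega> \<partial>dt)"
    using kernel_diff[OF indicator_kernel_integrable v u] AE_dtP_time
    by eventually_elim (auto simp: D_def h_def k_def inventory_eq)
  have D_int: "integrable dtP (\<lambda>(t, \<omega>). D t \<omega> * l t \<omega>)"
  proof -
    obtain C C' where C: "AE (t, \<omega>) in dtP. \<bar>inventory X0 v t \<omega>\<bar> \<le> C"
      and C': "AE (t, \<omega>) in dtP. \<bar>inventory X0 u t \<omega>\<bar> \<le> C'"
      using inventory_bounded[OF v] inventory_bounded[OF u] by metis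
    have "AE (t, \<omega>) in dtP. \<bar>D t \<omega>\<bar> \<le> C + C'"
      using C C' by eventually_elim (auto simp: D_def)
    from integrable_bounded_mult[OF D_meas this l] show ?thesis .
  qed
  have D_meas': "(\<lambda>(t, \<omega>). \<integral>s. k s t * h s \<omega> \<partial>dt) \<in> borel_measurable dtP"
    by (rule kernel_measurable) measurable
  have eq: "AE z in dtP. (case z of (t, \<omega>) \<Rightarrow> D t \<omega> * l t \<omega>)
      = (case z of (t, \<omega>) \<Rightarrow> l t \<omega> * (\<integral>s. k s t * h s \<omega> \<partial>dt))"
    using D_eq by eventually_elim auto
  have meas: "(\<lambda>(t, \<omega>). l t \<omega> * (\<integral>s. k s t * h s \<omega> \<partial>dt)) \<in> borel_measurable dtP"
    using D_meas' by measurable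
  have swap_int: "integrable dtP (\<lambda>(t, \<omega>). l t \<omega> * (\<integral>s. k s t * h s \<omega> \<partial>dt))"
    by (rule integrable_cong_AE_imp[OF D_int meas eq])
  \<comment> \<open>Along almost every path the integrand is dominated by
    \<open>\<bar>h t \<omega>\<bar> * \<bar>l s \<omega>\<bar>\<close>, a product of two integrable
    functions of one variable each.\<close>
  have triple: "AE \<omega> in \<mu>. integrable (dt \<Otimes>\<^sub>M dt) (\<lambda>(t, s). k t s * h t \<omega> * l s \<omega>)"
  proof -
    obtain C where C: "AE \<omega> in \<mu>. AE t in dt. \<bar>h t \<omega>\<bar> \<le> C"
      using Linf_procE[OF h] by metis
    show ?thesis
      using C l_section AE_space
    proof eventually_elim
      case (elim \<omega>)
      note [measurable] = elim(3)
      have "integrable dt (\<lambda>t. \<bar>h t \<omega>\<bar>)"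
        by (rule dt.integrable_const_bound[where B = C]) (use elim(1) in auto)
      then show "integrable (dt \<Otimes>\<^sub>M dt) (\<lambda>(t, s). k t s * h t \<omega> * l s \<omega>)"
      proof (intro dtdt.Fubini_integrable)
        assume h': "integrable dt (\<lambda>t. \<bar>h t \<omega>\<bar>)"
        show "integrable dt (\<lambda>t. \<integral>s. norm (case (t, s) of (t, s) \<Rightarrow> k t s * h t \<omega> * l s \<omega>) \<partial>dt)"
        proof (rule Bochner_Integration.integrable_bound[OF integrable_mult_left[OF h', of "\<integral>s. \<bar>l s \<omega>\<bar> \<partial>dt"]])
          show "AE t in dt. norm (\<integral>s. norm (case (t, s) of (t, s) \<Rightarrow> k t s * h t \<omega> * l s \<omega>) \<partial>dt)
              \<le> norm (\<bar>h t \<omega>\<bar> * (\<integral>s. \<bar>l s \<omega>\<bar> \<partial>dt))"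
          proof (rule AE_I2)
            fix t
            have "(\<integral>s. \<bar>k t s * h t \<omega> * l s \<omega>\<bar> \<partial>dt) \<le> (\<integral>s. \<bar>h t \<omega>\<bar> * \<bar>l s \<omega>\<bar> \<partial>dt)"
            proof (rule integral_mono_AE')
              show "AE s in dt. \<bar>k t s * h t \<omega> * l s \<omega>\<bar> \<le> \<bar>h t \<omega>\<bar> * \<bar>l s \<omega>\<bar>"
                using k_le by (intro AE_I2) (simp add: abs_mult mult_left_le_one_le mult.assoc)
            qed (use elim(2) in auto)
            then show "norm (\<integral>s. norm (case (t, s) of (t, s) \<Rightarrow> k t s * h t \<omega> * l s \<omega>) \<partial>dt)
                \<le> norm (\<bar>h t \<omega>\<bar> * (\<integral>s. \<bar>l s \<omega>\<bar> \<partial>dt))"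
              by simp
          qed
        qed measurable
        have "integrable dt (\<lambda>s. k t s * h t \<omega> * l s \<omega>)" if [measurable]: "t \<in> space dt" for t
          by (rule Bochner_Integration.integrable_bound[OF integrable_mult_right[OF elim(2), of "h t \<omega>"]])
            (measurable, use k_le in \<open>simp add: abs_mult mult_left_le_one_le mult.assoc\<close>)
        then show "AE t in dt. integrable dt (\<lambda>s. case (t, s) of (t, s) \<Rightarrow> k t s * h t \<omega> * l s \<omega>)"
          by auto
      qed measurable
    qed
  qed
  have "(\<integral>(t, \<omega>). h t \<omega> * \<psi> t \<omega> \<partial>dtP) = (\<integral>(t, \<omega>). h t \<omega> * Z t \<omega> \<partial>dtP)"
    using cond_exp_process_test(2)[OF h Z_int \<psi>'] .
  also have "\<dots> = (\<integral>(t, \<omega>). l t \<omega> * (\<integral>s. k s t * h s \<omega> \<partial>dt) \<partial>dtP)"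
    unfolding Z_def
    using kernel_integral_swap[OF triple integrable_Linf_mult[OF h Z_int[unfolded Z_def]] swap_int] .
  also have "\<dots> = (\<integral>(t, \<omega>). D t \<omega> * l t \<omega> \<partial>dtP)"
    by (rule integral_cong_AE) (use D_int meas eq in auto)
  finally show "(\<integral>(t, \<omega>). (v t \<omega> - u t \<omega>) * \<psi> t \<omega> \<partial>dtP)
      = (\<integral>(t, \<omega>). (inventory X0 v t \<omega> - inventory X0 u t \<omega>) * l t \<omega> \<partial>dtP)"
    unfolding h_def D_def .
qed

text \<open>Feasibility enters through \<open>v\<close> and slackness through \<open>u\<close>, one
  constraint at a time. Multipliers of upper bounds carry a minus sign, which is absorbed by
  reversing the difference. Each product is integrable as bounded times integrable, so the sum may
  be split.\<close>

lemma lagrangian_nonneg: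
  assumes a: "constraint_processes \<mu> F T X0 a1 a2 a3 a4"
    and l: "l1 \<in> L1_plus \<mu> F T" "l2 \<in> L1_plus \<mu> F T" "l3 \<in> L1_plus \<mu> F T" "l4 \<in> L1_plus \<mu> F T"
    and \<psi>: "cond_exp_process \<mu> F T (\<lambda>t \<omega>. LINT s:{t..T}|lborel. l3 s \<omega> - l4 s \<omega>) \<psi>"
    and u: "u \<in> admissible_controls \<mu> F T X0 a1 a2 a3 a4"
    and v: "v \<in> admissible_controls \<mu> F T X0 a1 a2 a3 a4"
    and slack1: "0 = (\<integral>\<omega>. (\<integral>t. (a1 t \<omega> - u t \<omega>) * l1 t \<omega> \<partial>dt) \<partial>\<mu>)"
    and slack2: "0 = (\<integral>\<omega>. (\<integral>t. (u t \<omega> - a2 t \<omega>) * l2 t \<omega> \<partial>dt) \<partial>\<mu>)"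
    and slack3: "0 = (\<integral>\<omega>. (\<integral>t. (a3 t \<omega> - inventory X0 u t \<omega>) * l3 t \<omega> \<partial>dt) \<partial>\<mu>)"
    and slack4: "0 = (\<integral>\<omega>. (\<integral>t. (inventory X0 u t \<omega> - a4 t \<omega>) * l4 t \<omega> \<partial>dt) \<partial>\<mu>)"
  shows "0 \<le> (\<integral>(t, \<omega>). (v t \<omega> - u t \<omega>) * (l1 t \<omega> - l2 t \<omega> + \<psi> t \<omega>) \<partial>dtP)"
proof -
  have u_inf: "u \<in> Linf_proc \<mu> F T" and v_inf: "v \<in> Linf_proc \<mu> F T"
    using u v by (auto simp: admissible_controls_def)
  have a_inf: "a1 \<in> Linf_proc \<mu> F T" "a2 \<in> Linf_proc \<mu> F T" "a3 \<in> Linf_proc \<mu> F T" "a4 \<in> Linf_proc \<mu> F T"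
    using a by (auto simp: constraint_processes_def)
  have L1: "AE (t, \<omega>) in dtP. 0 \<le> l t \<omega>" "integrable dtP (\<lambda>(t, \<omega>). l t \<omega>)"
    if "l \<in> L1_plus \<mu> F T" for l
    using that Lp_proc_integrable[of l 1] by (auto simp: L1_plus_def ae_dt_prob_def)
  have X_int: "integrable dtP (\<lambda>(t, \<omega>). inventory X0 w t \<omega> * l t \<omega>)"
    if w: "w \<in> Linf_proc \<mu> F T" and l: "l \<in> L1_plus \<mu> F T" for w l
  proof -
    obtain C where "AE (t, \<omega>) in dtP. \<bar>inventory X0 w t \<omega>\<bar> \<le> C"
      using inventory_bounded[OF w] .
    from integrable_bounded_mult[OF inventory_measurable[OF w] this L1(2)[OF l]] show ?thesis .
  qed
  have v_AE: "AE (t, \<omega>) in dtP. a1 t \<omega> \<le> v t \<omega> \<and> v t \<omega> \<le> a2 t \<omega> \<and>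
      a3 t \<omega> \<le> inventory X0 v t \<omega> \<and> inventory X0 v t \<omega> \<le> a4 t \<omega>"
    using v by (simp add: admissible_controls_def ae_dt_prob_def)
  note u_ints = integrable_Linf_mult[OF u_inf L1(2)]
  note v_ints = integrable_Linf_mult[OF v_inf L1(2)]
  note a_ints = a_inf[THEN integrable_Linf_mult, OF L1(2)]
  \<comment> \<open>With \<open>y\<close> the bound, the first identity is for lower bounds and the
    second for upper bounds.\<close>
  have cancel: "x - y + (y - z) = x - z" "y - x + (z - y) = z - x" for x y z :: real
    by simp_all
  have diff: "integrable dtP (\<lambda>(t, \<omega>). (x t \<omega> - y t \<omega>) * m t \<omega>)"
    if "integrable dtP (\<lambda>(t, \<omega>). x t \<omega> * m t \<omega>)" "integrable dtP (\<lambda>(t, \<omega>). y t \<omega> * m t \<omega>)"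
    for x y m :: "real \<Rightarrow> 'w \<Rightarrow> real"
    using Bochner_Integration.integrable_diff[OF that] by (simp add: case_prod_unfold left_diff_distrib)
  have s1: "integrable dtP (\<lambda>(t, \<omega>). (v t \<omega> - u t \<omega>) * l1 t \<omega>)"
    "0 \<le> (\<integral>(t, \<omega>). (v t \<omega> - u t \<omega>) * l1 t \<omega> \<partial>dtP)"
  proof -
    have "AE (t, \<omega>) in dtP. 0 \<le> v t \<omega> - a1 t \<omega>"
      using v_AE by eventually_elim auto
    note * = complementary_slackness[OF L1(1)[OF l(1)] this diff[OF v_ints[OF l(1)] a_ints(1)[OF l(1)]]
        diff[OF a_ints(1)[OF l(1)] u_ints[OF l(1)]] slack1]
    show "integrable dtP (\<lambda>(t, \<omega>). (v t \<omega> - u t \<omega>) * l1 t \<omega>)"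
      "0 \<le> (\<integral>(t, \<omega>). (v t \<omega> - u t \<omega>) * l1 t \<omega> \<partial>dtP)"
      using *[unfolded cancel(1)] .
  qed
  have s2: "integrable dtP (\<lambda>(t, \<omega>). (u t \<omega> - v t \<omega>) * l2 t \<omega>)"
    "0 \<le> (\<integral>(t, \<omega>). (u t \<omega> - v t \<omega>) * l2 t \<omega> \<partial>dtP)"
  proof -
    have "AE (t, \<omega>) in dtP. 0 \<le> a2 t \<omega> - v t \<omega>"
      using v_AE by eventually_elim auto
    note * = complementary_slackness[OF L1(1)[OF l(2)] this diff[OF a_ints(2)[OF l(2)] v_ints[OF l(2)]]
        diff[OF u_ints[OF l(2)] a_ints(2)[OF l(2)]] slack2]
    show "integrable dtP (\<lambda>(t, \<omega>). (u t \<omega> - v t \<omega>) * l2 t \<omega>)"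
      "0 \<le> (\<integral>(t, \<omega>). (u t \<omega> - v t \<omega>) * l2 t \<omega> \<partial>dtP)"
      using *[unfolded cancel(2)] .
  qed
  have s3: "integrable dtP (\<lambda>(t, \<omega>). (inventory X0 v t \<omega> - inventory X0 u t \<omega>) * l3 t \<omega>)"
    "0 \<le> (\<integral>(t, \<omega>). (inventory X0 v t \<omega> - inventory X0 u t \<omega>) * l3 t \<omega> \<partial>dtP)"
  proof -
    have "AE (t, \<omega>) in dtP. 0 \<le> inventory X0 v t \<omega> - a3 t \<omega>"
      using v_AE by eventually_elim auto
    note * = complementary_slackness[OF L1(1)[OF l(3)] this diff[OF X_int[OF v_inf l(3)] a_ints(3)[OF l(3)]]
        diff[OF a_ints(3)[OF l(3)] X_int[OF u_inf l(3)]] slack3]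
    show "integrable dtP (\<lambda>(t, \<omega>). (inventory X0 v t \<omega> - inventory X0 u t \<omega>) * l3 t \<omega>)"
      "0 \<le> (\<integral>(t, \<omega>). (inventory X0 v t \<omega> - inventory X0 u t \<omega>) * l3 t \<omega> \<partial>dtP)"
      using *[unfolded cancel(1)] .
  qed
  have s4: "integrable dtP (\<lambda>(t, \<omega>). (inventory X0 u t \<omega> - inventory X0 v t \<omega>) * l4 t \<omega>)"
    "0 \<le> (\<integral>(t, \<omega>). (inventory X0 u t \<omega> - inventory X0 v t \<omega>) * l4 t \<omega> \<partial>dtP)"
  proof -
    have "AE (t, \<omega>) in dtP. 0 \<le> a4 t \<omega> - inventory X0 v t \<omega>"
      using v_AE by eventually_elim auto
    note * = complementary_slackness[OF L1(1)[OF l(4)] this diff[OF a_ints(4)[OF l(4)] X_int[OF v_inf l(4)]]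
        diff[OF X_int[OF u_inf l(4)] a_ints(4)[OF l(4)]] slack4]
    show "integrable dtP (\<lambda>(t, \<omega>). (inventory X0 u t \<omega> - inventory X0 v t \<omega>) * l4 t \<omega>)"
      "0 \<le> (\<integral>(t, \<omega>). (inventory X0 u t \<omega> - inventory X0 v t \<omega>) * l4 t \<omega> \<partial>dtP)"
      using *[unfolded cancel(2)] .
  qed
  have "integrable dtP (\<lambda>(t, \<omega>). l3 t \<omega> - l4 t \<omega>)"
    using Bochner_Integration.integrable_diff[OF L1(2)[OF l(3)] L1(2)[OF l(4)]]
    by (simp add: case_prod_unfold)
  note tail = cond_exp_tail_integral_test(1)[OF this \<psi> u_inf v_inf]
    cond_exp_tail_integral_test(2)[OF this \<psi> u_inf v_inf, where ?X0.0 = X0]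
  have "(\<integral>(t, \<omega>). (v t \<omega> - u t \<omega>) * (l1 t \<omega> - l2 t \<omega> + \<psi> t \<omega>) \<partial>dtP)
      = (\<integral>z. (case z of (t, \<omega>) \<Rightarrow> (v t \<omega> - u t \<omega>) * l1 t \<omega>)
        + (case z of (t, \<omega>) \<Rightarrow> (u t \<omega> - v t \<omega>) * l2 t \<omega>)
        + (case z of (t, \<omega>) \<Rightarrow> (v t \<omega> - u t \<omega>) * \<psi> t \<omega>) \<partial>dtP)"
    by (rule Bochner_Integration.integral_cong) (auto simp: algebra_simps)
  also have "\<dots> = (\<integral>(t, \<omega>). (v t \<omega> - u t \<omega>) * l1 t \<omega> \<partial>dtP)
      + (\<integral>(t, \<omega>). (u t \<omega> - v t \<omega>) * l2 t \<omega> \<partial>dtP) + (\<integral>(t, \<omega>). (v t \<omega> - u t \<omega>) * \<psi> t \<omega> \<partial>dtP)"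
    by (simp only: Bochner_Integration.integral_add Bochner_Integration.integrable_add s1(1) s2(1) tail(1))
  also have "(\<integral>(t, \<omega>). (v t \<omega> - u t \<omega>) * \<psi> t \<omega> \<partial>dtP)
      = (\<integral>z. (case z of (t, \<omega>) \<Rightarrow> (inventory X0 v t \<omega> - inventory X0 u t \<omega>) * l3 t \<omega>)
        + (case z of (t, \<omega>) \<Rightarrow> (inventory X0 u t \<omega> - inventory X0 v t \<omega>) * l4 t \<omega>) \<partial>dtP)"
    unfolding tail(2) by (rule Bochner_Integration.integral_cong) (auto simp: algebra_simps)
  also have "\<dots> = (\<integral>(t, \<omega>). (inventory X0 v t \<omega> - inventory X0 u t \<omega>) * l3 t \<omega> \<partial>dtP)
      + (\<integral>(t, \<omega>). (inventory X0 u t \<omega> - inventory X0 v t \<omega>) * l4 t \<omega> \<partial>dtP)"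
    by (simp only: Bochner_Integration.integral_add s3(1) s4(1))
  finally show ?thesis
    using s1(2) s2(2) s3(2) s4(2) by linarith
qed

section \<open>Exact second-order expansion of the cost\<close>

text \<open>With \<open>v = u + h\<close> the expansion is exact. Since the kernel is not symmetric,
  it has two mixed terms, the kernel applied to \<open>u\<close> and paired with \<open>h\<close>,
  and the reverse. The Fredholm equation evaluates the first together with the remaining linear
  terms in \<open>h\<close>; its term with \<open>V\<close>, once the conditioning is removed and
  the times are exchanged, cancels the second.\<close>

lemma cost_difference:
  fixes X0 :: real
  assumes K: "admissible_kernel T K"
    and P: "P \<in> Lp_proc \<mu> F T 2" and P_T: "integrable \<mu> (P T)"
    and M: "square_int_martingale \<mu> F T M"
    and \<alpha>: "cond_exp_process \<mu> F T (\<lambda>t \<omega>. P T \<omega> - P t \<omega>) \<alpha>"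
    and \<phi>: "integrable dtP (\<lambda>(t, \<omega>). \<phi> t \<omega>)"
    and V: "cond_exp_field \<mu> F T u V"
    and fredholm: "ae_dt_prob \<mu> T (\<lambda>t \<omega>.
          u t \<omega> + (LINT s:{0..t}|lborel. K t s * u s \<omega>) + (LINT s:{t..T}|lborel. K s t * V t s \<omega>)
          = \<phi> t \<omega> + \<alpha> t \<omega>)"
    and u: "u \<in> Linf_proc \<mu> F T" and v: "v \<in> Linf_proc \<mu> F T"
  defines "J \<equiv> cost \<mu> T K X0 (\<lambda>t \<omega>. P t \<omega> + M t \<omega>)"
  shows "J u + (\<integral>(t, \<omega>). (v t \<omega> - u t \<omega>) * \<phi> t \<omega> \<partial>dtP) + 1/2 * (\<integral>(t, \<omega>). (v t \<omega> - u t \<omega>)\<^sup>2 \<partial>dtP) \<le> J v"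
proof -
  define h where "h t \<omega> = v t \<omega> - u t \<omega>" for t \<omega>
  define \<kappa> where "\<kappa> w t \<omega> = (\<integral>s. K t s * w s \<omega> \<partial>dt)" for w t and \<omega> :: 'w
  \<comment> \<open>By the Fredholm equation, \<open>g\<close> is \<open>h\<close> times the term with \<open>V\<close>; this form shows its integrability.\<close>
  define g where "g t \<omega> = h t \<omega> * (\<phi> t \<omega> + \<alpha> t \<omega> - u t \<omega> - \<kappa> u t \<omega>)" for t \<omega>
  have h: "h \<in> Linf_proc \<mu> F T"
    using Linf_proc_diff[OF v u] unfolding h_def .
  note K_int = admissible_kernel_integrable[OF K]
  have KT_int: "integrable (dt \<Otimes>\<^sub>M dt) (\<lambda>(t, s). K s t)"
    using dtdt.integrable_product_swap[OF K_int] by simp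
  have P_int: "integrable dtP (\<lambda>(t, \<omega>). P T \<omega> - P t \<omega>)"
    using Bochner_Integration.integrable_diff[OF integrable_dtP_snd[OF P_T] Lp_proc_integrable[OF P]]
    by (simp add: case_prod_unfold)
  note h\<phi> = integrable_Linf_mult[OF h \<phi>]
  note h\<kappa>h = kernel_integrable[OF K_int h h, folded \<kappa>_def]
  note u\<kappa>h = kernel_integrable[OF K_int h u, folded \<kappa>_def]
  note hh = integrable_Linf_mult[OF h Linf_proc_integrable[OF h]]
  note ints = h\<phi> h\<kappa>h u\<kappa>h hh cond_exp_process_test(1)[OF h P_int \<alpha>]
    kernel_integrable[OF K_int u h, folded \<kappa>_def] integrable_Linf_mult[OF h Linf_proc_integrable[OF u]]
  have g_int: "integrable dtP (\<lambda>(t, \<omega>). g t \<omega>)"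
    using ints[unfolded case_prod_unfold] by (simp add: g_def case_prod_unfold algebra_simps)
  \<comment> \<open>Causality extends both set integrals to the whole interval: \<open>K t s\<close>
    vanishes for \<open>s > t\<close>, and \<open>K s t\<close> vanishes for
    \<open>s < t\<close>.\<close>
  have g_eq: "AE (t, \<omega>) in dtP. g t \<omega> = h t \<omega> * (\<integral>s. K s t * V t s \<omega> \<partial>dt)"
    using fredholm[unfolded ae_dt_prob_def] AE_dtP_time
  proof (eventually_elim, clarify)
    fix t \<omega>
    assume *: "u t \<omega> + (LINT s:{0..t}|lborel. K t s * u s \<omega>) + (LINT s:{t..T}|lborel. K s t * V t s \<omega>)
        = \<phi> t \<omega> + \<alpha> t \<omega>" and t: "t \<in> {0..T}"
    have "(LINT s:{0..t}|lborel. K t s * u s \<omega>) = (\<integral>s. indicator {0..t} s * (K t s * u s \<omega>) \<partial>dt)"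
      using t by (intro set_integral_time_measure) auto
    also have "\<dots> = \<kappa> u t \<omega>"
      unfolding \<kappa>_def using t K
      by (intro Bochner_Integration.integral_cong) (auto simp: admissible_kernel_def indicator_def)
    finally have 1: "(LINT s:{0..t}|lborel. K t s * u s \<omega>) = \<kappa> u t \<omega>" .
    have "(LINT s:{t..T}|lborel. K s t * V t s \<omega>) = (\<integral>s. indicator {t..T} s * (K s t * V t s \<omega>) \<partial>dt)"
      using t by (intro set_integral_time_measure) auto
    also have "\<dots> = (\<integral>s. K s t * V t s \<omega> \<partial>dt)"
      using t K by (intro Bochner_Integration.integral_cong) (auto simp: admissible_kernel_def indicator_def)
    finally have "(\<integral>s. K s t * V t s \<omega> \<partial>dt) = \<phi> t \<omega> + \<alpha> t \<omega> - u t \<omega> - \<kappa> u t \<omega>"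
      using * 1 by simp
    then show "g t \<omega> = h t \<omega> * (\<integral>s. K s t * V t s \<omega> \<partial>dt)"
      by (simp add: g_def)
  qed
  \<comment> \<open>At almost every fixed \<open>t\<close>, \<open>V\<close> is replaced by
    \<open>u\<close> under the integral over paths. Fubini then turns the transposed kernel acting
    on \<open>u\<close> into the kernel acting on \<open>h\<close>.\<close>
  have g_swap: "(\<integral>(t, \<omega>). g t \<omega> \<partial>dtP) = (\<integral>(t, \<omega>). u t \<omega> * \<kappa> h t \<omega> \<partial>dtP)"
  proof -
    note hKu = kernel_integrable[OF KT_int u h]
    have [measurable]: "(\<lambda>(t, s). K s t) \<in> borel_measurable (dt \<Otimes>\<^sub>M dt)"
      using KT_int by auto
    note [measurable] = Linf_proc_measurable[OF h]
    have [measurable]: "(\<lambda>(t, \<omega>). g t \<omega>) \<in> borel_measurable dtP"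
      using g_int by auto
    have g_eq': "AE t in dt. AE \<omega> in \<mu>. g t \<omega> = h t \<omega> * (\<integral>s. K s t * V t s \<omega> \<partial>dt)"
      using dtP.AE_pair[OF g_eq] by simp
    have "(\<integral>(t, \<omega>). g t \<omega> \<partial>dtP) = (\<integral>t. (\<integral>\<omega>. g t \<omega> \<partial>\<mu>) \<partial>dt)"
      using dtP.integral_fst[OF g_int] by simp
    also have "\<dots> = (\<integral>t. (\<integral>\<omega>. h t \<omega> * (\<integral>s. K s t * u s \<omega> \<partial>dt) \<partial>\<mu>) \<partial>dt)"
    proof (rule integral_cong_AE)
      show "AE t in dt. (\<integral>\<omega>. g t \<omega> \<partial>\<mu>) = (\<integral>\<omega>. h t \<omega> * (\<integral>s. K s t * u s \<omega> \<partial>dt) \<partial>\<mu>)"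
        using g_eq' cond_exp_field_test[OF KT_int h u V] AE_space
      proof eventually_elim
        case (elim t)
        note [measurable] = elim(3)
        have "(\<integral>\<omega>. g t \<omega> \<partial>\<mu>) = (\<integral>\<omega>. h t \<omega> * (\<integral>s. K s t * V t s \<omega> \<partial>dt) \<partial>\<mu>)"
        proof (rule integral_cong_AE)
          have "(\<lambda>\<omega>. \<integral>s. K s t * V t s \<omega> \<partial>dt) \<in> borel_measurable \<mu>"
            by (rule cond_exp_field_kernel_measurable[OF _ V elim(3)]) measurable
          then show "(\<lambda>\<omega>. h t \<omega> * (\<integral>s. K s t * V t s \<omega> \<partial>dt)) \<in> borel_measurable \<mu>"
            by measurable
          show "AE \<omega> in \<mu>. g t \<omega> = h t \<omega> * (\<integral>s. K s t * V t s \<omega> \<partial>dt)"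
            using elim(1) .
        qed measurable
        with elim(2) show ?case
          by simp
      qed
    qed (intro borel_measurable_integrable dtP.integrable_fst[OF g_int] dtP.integrable_fst[OF hKu])+
    also have "\<dots> = (\<integral>(t, \<omega>). h t \<omega> * (\<integral>s. K s t * u s \<omega> \<partial>dt) \<partial>dtP)"
      using dtP.integral_fst[OF hKu] by simp
    also have "\<dots> = (\<integral>(t, \<omega>). u t \<omega> * \<kappa> h t \<omega> \<partial>dtP)"
      unfolding \<kappa>_def
      by (rule kernel_integral_swap[OF kernel_triple_integrable[OF KT_int h u] hKu
            kernel_integrable[OF K_int h u]])
    finally show ?thesis .
  qed
  have \<kappa>_pos: "0 \<le> (\<integral>(t, \<omega>). h t \<omega> * \<kappa> h t \<omega> \<partial>dtP)"
    using kernel_nonneg[OF K K_int h] by (simp add: \<kappa>_def)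
  define Q where "Q w t \<omega> = w t \<omega> * (1/2 * w t \<omega> + \<kappa> w t \<omega> - \<alpha> t \<omega>)" for w t \<omega>
  have Q_int: "integrable dtP (\<lambda>(t, \<omega>). Q w t \<omega>)"
    and Q_cost: "J w = (\<integral>(t, \<omega>). Q w t \<omega> \<partial>dtP) - X0 * (\<integral>\<omega>. P T \<omega> + M T \<omega> \<partial>\<mu>)"
    if "w \<in> Linf_proc \<mu> F T" for w
    using cost_eq[OF K P P_T M \<alpha> that] by (simp_all add: Q_def \<kappa>_def J_def)
  have "J v - J u = (\<integral>z. (case z of (t, \<omega>) \<Rightarrow> Q v t \<omega>) - (case z of (t, \<omega>) \<Rightarrow> Q u t \<omega>) \<partial>dtP)"
    unfolding Q_cost[OF u] Q_cost[OF v] Bochner_Integration.integral_diff[OF Q_int[OF v] Q_int[OF u]]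
    by linarith
  also have "\<dots> = (\<integral>z. (case z of (t, \<omega>) \<Rightarrow> h t \<omega> * \<phi> t \<omega>) - (case z of (t, \<omega>) \<Rightarrow> g t \<omega>)
      + 1/2 * (case z of (t, \<omega>) \<Rightarrow> h t \<omega> * h t \<omega>) + (case z of (t, \<omega>) \<Rightarrow> h t \<omega> * \<kappa> h t \<omega>)
      + (case z of (t, \<omega>) \<Rightarrow> u t \<omega> * \<kappa> h t \<omega>) \<partial>dtP)"
  proof (rule integral_cong_AE)
    show "AE z in dtP. (case z of (t, \<omega>) \<Rightarrow> Q v t \<omega>) - (case z of (t, \<omega>) \<Rightarrow> Q u t \<omega>)
      = (case z of (t, \<omega>) \<Rightarrow> h t \<omega> * \<phi> t \<omega>) - (case z of (t, \<omega>) \<Rightarrow> g t \<omega>)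
      + 1/2 * (case z of (t, \<omega>) \<Rightarrow> h t \<omega> * h t \<omega>) + (case z of (t, \<omega>) \<Rightarrow> h t \<omega> * \<kappa> h t \<omega>)
      + (case z of (t, \<omega>) \<Rightarrow> u t \<omega> * \<kappa> h t \<omega>)"
      using kernel_diff[OF K_int v u, folded h_def, folded \<kappa>_def]
    proof (eventually_elim, clarify)
      fix t \<omega> assume "\<kappa> h t \<omega> = \<kappa> v t \<omega> - \<kappa> u t \<omega>"
      then have \<kappa>v: "\<kappa> v t \<omega> = \<kappa> u t \<omega> + \<kappa> h t \<omega>"
        by simp
      have v_eq: "v t \<omega> = u t \<omega> + h t \<omega>"
        by (simp add: h_def)
      \<comment> \<open>Given the relation between the three kernel integrals, this is pure algebra
        from the definition of \<open>g\<close>; the Fredholm equation enters through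
        \<open>g_swap\<close>.\<close>
      show "Q v t \<omega> - Q u t \<omega> = h t \<omega> * \<phi> t \<omega> - g t \<omega> + 1/2 * (h t \<omega> * h t \<omega>) + h t \<omega> * \<kappa> h t \<omega> + u t \<omega> * \<kappa> h t \<omega>"
        unfolding Q_def g_def \<kappa>v v_eq by algebra
    qed
  qed (intro borel_measurable_integrable Bochner_Integration.integrable_add
      Bochner_Integration.integrable_diff integrable_mult_right Q_int u v h\<phi> g_int hh h\<kappa>h u\<kappa>h)+
  also have "\<dots> = (\<integral>(t, \<omega>). h t \<omega> * \<phi> t \<omega> \<partial>dtP) - (\<integral>(t, \<omega>). g t \<omega> \<partial>dtP)
      + 1/2 * (\<integral>(t, \<omega>). h t \<omega> * h t \<omega> \<partial>dtP) + (\<integral>(t, \<omega>). h t \<omega> * \<kappa> h t \<omega> \<partial>dtP)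
      + (\<integral>(t, \<omega>). u t \<omega> * \<kappa> h t \<omega> \<partial>dtP)"
    by (simp only: Bochner_Integration.integral_add Bochner_Integration.integral_diff
        integral_mult_right_zero Bochner_Integration.integrable_add Bochner_Integration.integrable_diff
        integrable_mult_right h\<phi> g_int hh h\<kappa>h u\<kappa>h)
  \<comment> \<open>By \<open>g_swap\<close> the integral of \<open>g\<close> cancels the last mixed
    term, and positivity of the kernel discards the term quadratic in \<open>h\<close>.\<close>
  finally have "J u + (\<integral>(t, \<omega>). h t \<omega> * \<phi> t \<omega> \<partial>dtP) + 1/2 * (\<integral>(t, \<omega>). h t \<omega> * h t \<omega> \<partial>dtP) \<le> J v"
    using g_swap \<kappa>_pos by linarith
  then show ?thesis
    unfolding h_def power2_eq_square .
qed

end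

section \<open>Optimality and uniqueness\<close>

theorem theorem2p8:
  fixes \<mu> :: "'w::polish_space measure"
    and F :: "real \<Rightarrow> 'w measure"
    and T X0 :: real
    and P M \<alpha> :: "real \<Rightarrow> 'w \<Rightarrow> real"
    and K :: "real \<Rightarrow> real \<Rightarrow> real"
    and a1 a2 a3 a4 :: "real \<Rightarrow> 'w \<Rightarrow> real"
    and l1 l2 l3 l4 \<psi> \<phi> u :: "real \<Rightarrow> 'w \<Rightarrow> real"
    and V :: "real \<Rightarrow> real \<Rightarrow> 'w \<Rightarrow> real"
    and S :: "real \<Rightarrow> 'w \<Rightarrow> real"
    and J :: "(real \<Rightarrow> 'w \<Rightarrow> real) \<Rightarrow> real"
    and U :: "(real \<Rightarrow> 'w \<Rightarrow> real) set"
  assumes S: "S = (\<lambda>t \<omega>. P t \<omega> + M t \<omega>)"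
    and J: "J = cost \<mu> T K X0 S"
    and U: "U = admissible_controls \<mu> F T X0 a1 a2 a3 a4"
    and T_pos: "0 < T"
    and filtered: "usual_filtration \<mu> F T"
    and P_fv: "finite_variation_process \<mu> T P"
    and P_L2: "P \<in> Lp_proc \<mu> F T 2"
    and P_T_integrable: "integrable \<mu> (P T)"
    and M_mart: "square_int_martingale \<mu> F T M"
    and M_centered: "centered \<mu> T M"
    and alpha: "cond_exp_process \<mu> F T (\<lambda>t \<omega>. P T \<omega> - P t \<omega>) \<alpha>"
    and constraints: "constraint_processes \<mu> F T X0 a1 a2 a3 a4"
    and kernel: "admissible_kernel T K"
    and multipliers: "l1 \<in> L1_plus \<mu> F T" "l2 \<in> L1_plus \<mu> F T"
      "l3 \<in> L1_plus \<mu> F T" "l4 \<in> L1_plus \<mu> F T"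
    and psi: "cond_exp_process \<mu> F T (\<lambda>t \<omega>. LINT s:{t..T}|lborel. l3 s \<omega> - l4 s \<omega>) \<psi>"
    and phi: "\<phi> = (\<lambda>t \<omega>. l1 t \<omega> - l2 t \<omega> + \<psi> t \<omega>)"
    and phi_L2: "\<phi> \<in> Lp_proc \<mu> F T 2"
    and u_L2: "u \<in> Lp_proc \<mu> F T 2"
    and cond_u: "cond_exp_field \<mu> F T u V"
    and fredholm: "ae_dt_prob \<mu> T (\<lambda>t \<omega>.
          u t \<omega> + (LINT s:{0..t}|lborel. K t s * u s \<omega>) + (LINT s:{t..T}|lborel. K s t * V t s \<omega>)
          = \<phi> t \<omega> + \<alpha> t \<omega>)"
    and u_admissible: "u \<in> U"
    and slack1: "0 = (\<integral>\<omega>. (\<integral>t. (a1 t \<omega> - u t \<omega>) * l1 t \<omega> \<partial>time_measure T) \<partial>\<mu>)"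
    and slack2: "0 = (\<integral>\<omega>. (\<integral>t. (u t \<omega> - a2 t \<omega>) * l2 t \<omega> \<partial>time_measure T) \<partial>\<mu>)"
    and slack3: "0 = (\<integral>\<omega>. (\<integral>t. (a3 t \<omega> - inventory X0 u t \<omega>) * l3 t \<omega> \<partial>time_measure T) \<partial>\<mu>)"
    and slack4: "0 = (\<integral>\<omega>. (\<integral>t. (inventory X0 u t \<omega> - a4 t \<omega>) * l4 t \<omega> \<partial>time_measure T) \<partial>\<mu>)"
  shows "minimizer_on J U u \<and>
         (\<forall>v. minimizer_on J U v \<longrightarrow> ae_dt_prob \<mu> T (\<lambda>t \<omega>. u t \<omega> = v t \<omega>))"
proof -
  interpret filtered_space \<mu> F T
    using filtered T_pos by unfold_locales
  have Linf: "w \<in> Linf_proc \<mu> F T" if "w \<in> U" for w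
    using that by (simp add: U admissible_controls_def)
  note u_inf = Linf[OF u_admissible]
  have \<phi>_int: "integrable dtP (\<lambda>(t, \<omega>). \<phi> t \<omega>)"
    using Lp_proc_integrable[OF phi_L2] by simp
  have gap: "J u + 1/2 * (\<integral>(t, \<omega>). (v t \<omega> - u t \<omega>)\<^sup>2 \<partial>dtP) \<le> J v" if v: "v \<in> U" for v
  proof -
    have "cost \<mu> T K X0 (\<lambda>t \<omega>. P t \<omega> + M t \<omega>) u + (\<integral>(t, \<omega>). (v t \<omega> - u t \<omega>) * \<phi> t \<omega> \<partial>dtP)
        + 1/2 * (\<integral>(t, \<omega>). (v t \<omega> - u t \<omega>)\<^sup>2 \<partial>dtP) \<le> cost \<mu> T K X0 (\<lambda>t \<omega>. P t \<omega> + M t \<omega>) v"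
      by (rule cost_difference[OF kernel P_L2 P_T_integrable M_mart alpha \<phi>_int cond_u fredholm
            u_inf Linf[OF v]])
    moreover have "0 \<le> (\<integral>(t, \<omega>). (v t \<omega> - u t \<omega>) * \<phi> t \<omega> \<partial>dtP)"
      unfolding phi
      by (rule lagrangian_nonneg[OF constraints multipliers psi u_admissible[unfolded U] v[unfolded U]
            slack1 slack2 slack3 slack4])
    ultimately show ?thesis
      by (simp add: J S)
  qed
  have sq_nonneg: "0 \<le> (\<integral>(t, \<omega>). (v t \<omega> - u t \<omega>)\<^sup>2 \<partial>dtP)" for v
    by (rule Bochner_Integration.integral_nonneg) auto
  have min: "minimizer_on J U u"
    unfolding minimizer_on_def
  proof (intro conjI antisym INF_greatest INF_lower u_admissible)
    fix v assume "v \<in> U"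
    then show "ereal (J u) \<le> ereal (J v)"
      using gap[of v] sq_nonneg[of v] by simp
  qed
  have "ae_dt_prob \<mu> T (\<lambda>t \<omega>. u t \<omega> = v t \<omega>)" if v: "minimizer_on J U v" for v
  proof -
    have v_U: "v \<in> U"
      using v by (simp add: minimizer_on_def)
    \<comment> \<open>Both controls attain the same infimum, so the gap inequality leaves no room
      for a positive square term.\<close>
    have "ereal (J v) = ereal (J u)"
      using v min unfolding minimizer_on_def by (metis (no_types))
    then have "(\<integral>(t, \<omega>). (v t \<omega> - u t \<omega>)\<^sup>2 \<partial>dtP) = 0"
      using gap[OF v_U] sq_nonneg[of v] by simp
    \<comment> \<open>Integrability excludes that the zero just found is only the default value of
      the integral.\<close>
    moreover have "integrable dtP (\<lambda>(t, \<omega>). (v t \<omega> - u t \<omega>)\<^sup>2)"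
      using integrable_Linf_mult[OF Linf_proc_diff Linf_proc_integrable[OF Linf_proc_diff],
          OF Linf[OF v_U] u_inf Linf[OF v_U] u_inf]
      by (simp add: power2_eq_square)
    moreover have "AE z in dtP. 0 \<le> (case z of (t, \<omega>) \<Rightarrow> (v t \<omega> - u t \<omega>)\<^sup>2)"
      by (rule AE_I2) (simp split: prod.split)
    ultimately have "AE z in dtP. (case z of (t, \<omega>) \<Rightarrow> (v t \<omega> - u t \<omega>)\<^sup>2) = 0"
      using integral_nonneg_eq_0_iff_AE by blast
    then show ?thesis
      unfolding ae_dt_prob_def
    proof eventually_elim
      case (elim z)
      then show ?case
        by (cases z) simp
    qed
  qed
  with min show ?thesis
    by blast
qed

end
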